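(* Up to isomorphism there are exactly $18$ complex $4$-dimensional nontrivial nilpotent noncommutative Jordan algebras. They are the following pairwise non-isomorphic algebras with basis $e_1,e_2,e_3,e_4$ (products of basis elements not listed are zero): \begin{itemize} \item $\mathcal{J}^4_{01}$: $e_1e_1=e_2,\ e_1e_2=e_3,\ e_2e_1=e_3$; \item $\mathcal{J}^4_{02}$: $e_1e_1=e_2,\ e_2e_3=e_4,\ e_3e_2=e_4,\ e_3e_1=e_4$; \item $\mathcal{J}^4_{03}$: $e_1e_1=e_2,\ e_1e_2=e_4,\ e_2e_1=e_4,\ e_3e_1=e_4,\ e_3e_3=e_4$; \item $\mathcal{J}^4_{04}$: $e_1e_1=e_2,\ e_1e_2=e_4,\ e_2e_1=e_4,\ e_3e_1=e_4$; \item $\mathcal{J}^4_{05}$: $e_1e_1=e_2,\ e_2e_3=e_4,\ e_3e_2=e_4$; \item $\mathcal{J}^4_{06}$: $e_1e_1=e_2,\ e_1e_2=e_4,\ e_2e_1=e_4,\ e_3e_3=e_4$; \item $\mathcal{J}^4_{07}$: $e_1e_2=e_3,\ e_1e_3=e_4,\ e_2e_1=e_3+e_4,\ e_2e_3=e_4,\ e_3e_1=e_4,\ e_3e_2=e_4$; \item $\mathcal{J}^4_{08}$: $e_1e_2=e_3,\ e_1e_3=e_4,\ e_2e_1=e_3+e_4,\ e_2e_2=e_4,\ e_3e_1=e_4$; \item $\mathcal{J}^4_{09}$: $e_1e_2=e_3,\ e_1e_3=e_4,\ e_2e_1=e_3+e_4,\ e_3e_1=e_4$; \item $\mathcal{J}^4_{10}$: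 $e_1e_2=e_3,\ e_1e_3=e_4,\ e_2e_1=e_3,\ e_2e_3=e_4,\ e_3e_1=e_4,\ e_3e_2=e_4$; \item $\mathcal{J}^4_{11}$: $e_1e_2=e_3,\ e_1e_3=e_4,\ e_2e_1=e_3,\ e_3e_1=e_4$; \item $\mathcal{J}^4_{12}$: $e_1e_2=e_3,\ e_1e_3=e_4,\ e_2e_1=e_3,\ e_2e_2=e_4,\ e_3e_1=e_4$; \item $\mathcal{J}^4_{13}$: $e_1e_2=e_3,\ e_1e_3=e_4,\ e_2e_1=-e_3,\ e_3e_1=-e_4$; \item $\mathcal{J}^4_{14}$: $e_1e_1=e_4,\ e_1e_2=e_3,\ e_1e_3=e_4,\ e_2e_1=-e_3,\ e_3e_1=-e_4$; \item $\mathcal{J}^4_{15}$: $e_1e_2=e_3,\ e_1e_3=e_4,\ e_2e_1=-e_3+e_4,\ e_3e_1=-e_4$; \item $\mathcal{J}^4_{16}$: $e_1e_2=e_3,\ e_1e_3=e_4,\ e_2e_1=-e_3,\ e_2e_2=e_4,\ e_3e_1=-e_4$; \item $\mathcal{J}^4_{17}$: $e_1e_1=e_4,\ e_1e_2=e_3,\ e_1e_3=e_4,\ e_2e_1=-e_3,\ e_2e_2=e_4,\ e_3e_1=-e_4$; \item $\mathcal{J}^4_{18}$: $e_1e_1=e_2,\ e_1e_2=e_3,\ e_1e_3=e_4,\ e_2e_1=e_3,\ e_2e_2=e_4,\ e_3e_1=e_4$. \end{itemize} That is, each of these $18$ algebras is a nontrivial nilpotent noncommutative Jordan algebra, and every complex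 $4$-dimensional nontrivial nilpotent noncommutative Jordan algebra is isomorphic to exactly one of them.
   Context: An algebra over $\mathbb{C}$ is a $\mathbb{C}$-vector space with a bilinear (not necessarily associative, commutative or unital) multiplication. A noncommutative Jordan algebra is an algebra satisfying the identities $x(yx)=(xy)x$ and $x^2(yx)=(x^2y)x$ for all $x,y$, where $x^2=xx$ ("noncommutative" means not necessarily commutative). An algebra $\mathbf{A}$ is nilpotent if $\mathbf{A}^k=0$ for some $k$, where $\mathbf{A}^1=\mathbf{A}$ and $\mathbf{A}^{k}=\sum_{i=1}^{k-1}\mathbf{A}^i\mathbf{A}^{k-i}$. "Nontrivial" (also called "pure") means that the algebra does not satisfy the identity $xyz=0$, i.e. it is not the case that both $(xy)z=0$ and $x(yz)=0$ hold for all $x,y,z$ (the algebra is not $2$-step nilpotent and does not have zero product). *)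

theory Defs
  imports "HOL-Analysis.Analysis"
begin

locale complex_algebra = vector_space smul
  for smul :: "complex \<Rightarrow> 'a::ab_group_add \<Rightarrow> 'a" +
  fixes amul :: "'a \<Rightarrow> 'a \<Rightarrow> 'a"  (infixl \<open>\<odot>\<close> 70)
  assumes mult_add_left: "(x + y) \<odot> z = x \<odot> z + y \<odot> z"
    and mult_add_right: "x \<odot> (y + z) = x \<odot> y + x \<odot> z"
    and mult_scale_left: "smul c x \<odot> y = smul c (x \<odot> y)"
    and mult_scale_right: "x \<odot> smul c y = smul c (x \<odot> y)"
begin

(* For k >= 2 the sum of the subspaces A^i A^(k-i), 0 < i < k, is the span of all the
   products involved. The exponent 0 is meaningless and gets the value of exponent 1. *)
fun alg_power :: "nat \<Rightarrow> 'a set" where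
  "alg_power k =
    (if k \<le> 1 then UNIV
     else span {x \<odot> y | x y. \<exists>i\<in>{1..<k}. x \<in> alg_power i \<and> y \<in> alg_power (k - i)})"

declare alg_power.simps [simp del]

definition nilpotent :: bool where
  "nilpotent \<longleftrightarrow> (\<exists>k\<ge>1. alg_power k = {0})"

definition nontrivial :: bool where
  "nontrivial \<longleftrightarrow> \<not> (\<forall>x y z. (x \<odot> y) \<odot> z = 0 \<and> x \<odot> (y \<odot> z) = 0)"

end

locale noncommutative_jordan_algebra = complex_algebra +
  assumes flexible: "x \<odot> (y \<odot> x) = (x \<odot> y) \<odot> x"
    and jordan: "(x \<odot> x) \<odot> (y \<odot> x) = ((x \<odot> x) \<odot> y) \<odot> x"

(* vector_space.dim is 0 for infinite-dimensional spaces, so dim = 4 includes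
   finite-dimensionality. *)
definition nontrivial_nilpotent_ncj_dim4 ::
    "(complex \<Rightarrow> 'a::ab_group_add \<Rightarrow> 'a) \<Rightarrow> ('a \<Rightarrow> 'a \<Rightarrow> 'a) \<Rightarrow> bool" where
  "nontrivial_nilpotent_ncj_dim4 smul amul \<longleftrightarrow>
     noncommutative_jordan_algebra smul amul \<and>
     vector_space.dim smul (UNIV :: 'a set) = 4 \<and>
     complex_algebra.nilpotent smul amul \<and>
     complex_algebra.nontrivial amul"

definition algebra_isomorphic ::
    "(complex \<Rightarrow> 'a::ab_group_add \<Rightarrow> 'a) \<Rightarrow> ('a \<Rightarrow> 'a \<Rightarrow> 'a) \<Rightarrow>
     (complex \<Rightarrow> 'b::ab_group_add \<Rightarrow> 'b) \<Rightarrow> ('b \<Rightarrow> 'b \<Rightarrow> 'b) \<Rightarrow> bool" where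
  "algebra_isomorphic smul amul smul' amul' \<longleftrightarrow>
     (\<exists>f. Vector_Spaces.linear smul smul' f \<and> bij f \<and>
          (\<forall>x y. f (amul x y) = amul' (f x) (f y)))"

(* In the index type 4 the numeral 4 denotes 0; 1, 2, 3, 4 are its four distinct elements. *)
abbreviation bv :: "4 \<Rightarrow> complex ^ 4" where
  "bv i \<equiv> axis i 1"

(* Entry n - 1 of the list is the multiplication table of the n-th algebra on the basis vectors. *)
definition J_table :: "nat \<Rightarrow> 4 \<times> 4 \<Rightarrow> complex ^ 4" where
  "J_table n =
    [
      (\<lambda>_. 0)((1,1) := bv 2, (1,2) := bv 3, (2,1) := bv 3),
      (\<lambda>_. 0)((1,1) := bv 2, (2,3) := bv 4, (3,2) := bv 4, (3,1) := bv 4),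
      (\<lambda>_. 0)((1,1) := bv 2, (1,2) := bv 4, (2,1) := bv 4, (3,1) := bv 4, (3,3) := bv 4),
      (\<lambda>_. 0)((1,1) := bv 2, (1,2) := bv 4, (2,1) := bv 4, (3,1) := bv 4),
      (\<lambda>_. 0)((1,1) := bv 2, (2,3) := bv 4, (3,2) := bv 4),
      (\<lambda>_. 0)((1,1) := bv 2, (1,2) := bv 4, (2,1) := bv 4, (3,3) := bv 4),
      (\<lambda>_. 0)((1,2) := bv 3, (1,3) := bv 4, (2,1) := bv 3 + bv 4, (2,3) := bv 4, (3,1) := bv 4, (3,2) := bv 4),
      (\<lambda>_. 0)((1,2) := bv 3, (1,3) := bv 4, (2,1) := bv 3 + bv 4, (2,2) := bv 4, (3,1) := bv 4),
      (\<lambda>_. 0)((1,2) := bv 3, (1,3) := bv 4, (2,1) := bv 3 + bv 4, (3,1) := bv 4),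
      (\<lambda>_. 0)((1,2) := bv 3, (1,3) := bv 4, (2,1) := bv 3, (2,3) := bv 4, (3,1) := bv 4, (3,2) := bv 4),
      (\<lambda>_. 0)((1,2) := bv 3, (1,3) := bv 4, (2,1) := bv 3, (3,1) := bv 4),
      (\<lambda>_. 0)((1,2) := bv 3, (1,3) := bv 4, (2,1) := bv 3, (2,2) := bv 4, (3,1) := bv 4),
      (\<lambda>_. 0)((1,2) := bv 3, (1,3) := bv 4, (2,1) := - bv 3, (3,1) := - bv 4),
      (\<lambda>_. 0)((1,1) := bv 4, (1,2) := bv 3, (1,3) := bv 4, (2,1) := - bv 3, (3,1) := - bv 4),
      (\<lambda>_. 0)((1,2) := bv 3, (1,3) := bv 4, (2,1) := - bv 3 + bv 4, (3,1) := - bv 4),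
      (\<lambda>_. 0)((1,2) := bv 3, (1,3) := bv 4, (2,1) := - bv 3, (2,2) := bv 4, (3,1) := - bv 4),
      (\<lambda>_. 0)((1,1) := bv 4, (1,2) := bv 3, (1,3) := bv 4, (2,1) := - bv 3, (2,2) := bv 4, (3,1) := - bv 4),
      (\<lambda>_. 0)((1,1) := bv 2, (1,2) := bv 3, (1,3) := bv 4, (2,1) := bv 3, (2,2) := bv 4, (3,1) := bv 4)
    ] ! (n - 1)"

definition J_mult :: "nat \<Rightarrow> complex ^ 4 \<Rightarrow> complex ^ 4 \<Rightarrow> complex ^ 4" where
  "J_mult n x y = (\<Sum>i\<in>UNIV. \<Sum>j\<in>UNIV. (x $ i * y $ j) *s J_table n (i, j))"

end

(* Let A^2 and A^3 be the first terms of the lower central series of a nilpotent algebra A of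
   dimension 4. If A/A^2 is a line, power associativity in low degree forces A to be the algebra of
   the powers of one element, J_18. Otherwise, A being nontrivial, A/A^2 is a plane and A^2/A^3 and
   A^3 are lines. The identities force A^2 A^2 = 0, so A is given by two bilinear forms b, g on the
   plane (products of generators modulo A^3 and their A^3 part) and two linear forms l, m on it
   (multiplication of A^2/A^3 into A^3 from both sides). Flexibility says
   b(y,x) l(x) = b(x,y) m(x), so either m = l and b is symmetric, or m = -l and b is alternating;
   the Jordan identity gives nothing more for degree reasons. In both cases g matters only modulo
   multiples of b and forms obtained from l by changing the lifts of the generators, and normalizing
   b and g relative to the line l = 0 leaves 12 + 5 algebras. They are told apart by
   isomorphism-invariant sentences about the annihilator {x. x A^2 = 0}, the preimage of that line. *)
theory Submission
  imports Defs
begin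

section \<open>The listed algebras in coordinates: identities, nilpotency, nontriviality\<close>

section \<open>The eighteen algebras\<close>

definition vec4 :: "complex \<Rightarrow> complex \<Rightarrow> complex \<Rightarrow> complex \<Rightarrow> complex ^ 4" where
  "vec4 a b c d = (\<chi> i. if i = 1 then a else if i = 2 then b else if i = 3 then c else d)"

lemma vec4_nth [simp]:
  "vec4 a b c d $ 1 = a" "vec4 a b c d $ 2 = b" "vec4 a b c d $ 3 = c" "vec4 a b c d $ 4 = d"
  by (simp_all add: vec4_def)

lemma complex4_eq_iff: "x = y \<longleftrightarrow> x $ 1 = y $ 1 \<and> x $ 2 = y $ 2 \<and> x $ 3 = y $ 3 \<and> x $ 4 = y $ 4"
  for x y :: "complex ^ 4"
  by (simp add: vec_eq_iff forall_4)

lemma J_mult_eq: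
  "J_mult 1 x y = vec4 0 (x$1 * y$1) (x$1 * y$2 + x$2 * y$1) 0"
  "J_mult 2 x y = vec4 0 (x$1 * y$1) 0 (x$2 * y$3 + x$3 * y$2 + x$3 * y$1)"
  "J_mult 3 x y = vec4 0 (x$1 * y$1) 0 (x$1 * y$2 + x$2 * y$1 + x$3 * y$1 + x$3 * y$3)"
  "J_mult 4 x y = vec4 0 (x$1 * y$1) 0 (x$1 * y$2 + x$2 * y$1 + x$3 * y$1)"
  "J_mult 5 x y = vec4 0 (x$1 * y$1) 0 (x$2 * y$3 + x$3 * y$2)"
  "J_mult 6 x y = vec4 0 (x$1 * y$1) 0 (x$1 * y$2 + x$2 * y$1 + x$3 * y$3)"
  "J_mult 7 x y = vec4 0 0 (x$1 * y$2 + x$2 * y$1)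
    (x$1 * y$3 + x$2 * y$1 + x$2 * y$3 + x$3 * y$1 + x$3 * y$2)"
  "J_mult 8 x y = vec4 0 0 (x$1 * y$2 + x$2 * y$1) (x$1 * y$3 + x$2 * y$1 + x$2 * y$2 + x$3 * y$1)"
  "J_mult 9 x y = vec4 0 0 (x$1 * y$2 + x$2 * y$1) (x$1 * y$3 + x$2 * y$1 + x$3 * y$1)"
  "J_mult 10 x y = vec4 0 0 (x$1 * y$2 + x$2 * y$1)
    (x$1 * y$3 + x$2 * y$3 + x$3 * y$1 + x$3 * y$2)"
  "J_mult 11 x y = vec4 0 0 (x$1 * y$2 + x$2 * y$1) (x$1 * y$3 + x$3 * y$1)"
  "J_mult 12 x y = vec4 0 0 (x$1 * y$2 + x$2 * y$1) (x$1 * y$3 + x$2 * y$2 + x$3 * y$1)"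
  "J_mult 13 x y = vec4 0 0 (x$1 * y$2 - x$2 * y$1) (x$1 * y$3 - x$3 * y$1)"
  "J_mult 14 x y = vec4 0 0 (x$1 * y$2 - x$2 * y$1) (x$1 * y$1 + x$1 * y$3 - x$3 * y$1)"
  "J_mult 15 x y = vec4 0 0 (x$1 * y$2 - x$2 * y$1) (x$1 * y$3 + x$2 * y$1 - x$3 * y$1)"
  "J_mult 16 x y = vec4 0 0 (x$1 * y$2 - x$2 * y$1) (x$1 * y$3 + x$2 * y$2 - x$3 * y$1)"
  "J_mult 17 x y = vec4 0 0 (x$1 * y$2 - x$2 * y$1) (x$1 * y$1 + x$1 * y$3 + x$2 * y$2 - x$3 * y$1)"
  "J_mult 18 x y = vec4 0 (x$1 * y$1) (x$1 * y$2 + x$2 * y$1) (x$1 * y$3 + x$2 * y$2 + x$3 * y$1)"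
  by (simp_all add: J_mult_def J_table_def sum_4 complex4_eq_iff axis_def fun_upd_def algebra_simps)

text \<open>The simplifier turns the index 1 into \<open>Suc 0\<close>, so the first equation has to
  be available in both forms.\<close>

lemmas J_mult_simps = J_mult_eq J_mult_eq(1)[unfolded One_nat_def]

lemma range_1_18: "{1..18} = {1, 2, 3, 4, 5, 6, 7, 8, 9, 10, 11, 12, 13, 14, 15, 16, 17, 18 :: nat}"
  by (auto simp: set_eq_iff; presburger)

lemma complex_algebra_J_mult: "complex_algebra (*s) (J_mult n)"
proof unfold_locales
  fix x y z :: "complex ^ 4" and c
  show "J_mult n (x + y) z = J_mult n x z + J_mult n y z"
    by (simp add: J_mult_def sum.distrib vec.scale_left_distrib distrib_right)
  show "J_mult n x (y + z) = J_mult n x y + J_mult n x z"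
    by (simp add: J_mult_def sum.distrib vec.scale_left_distrib distrib_left)
  show "J_mult n (c *s x) y = c *s J_mult n x y"
    by (simp add: J_mult_def vec.scale_sum_right mult.assoc)
  show "J_mult n x (c *s y) = c *s J_mult n x y"
    by (simp add: J_mult_def vec.scale_sum_right mult.left_commute)
qed

lemma noncommutative_jordan_algebra_J_mult:
  assumes "n \<in> {1..18}"
  shows "noncommutative_jordan_algebra (*s) (J_mult n)"
proof -
  interpret complex_algebra "(*s)" "J_mult n" by (rule complex_algebra_J_mult)
  show ?thesis
  proof
    fix x y :: "complex ^ 4"
    show "J_mult n x (J_mult n y x) = J_mult n (J_mult n x y) x"
      using assms unfolding range_1_18
      by (elim insertE emptyE) (simp_all add: J_mult_simps complex4_eq_iff algebra_simps)
    show "J_mult n (J_mult n x x) (J_mult n y x) = J_mult n (J_mult n (J_mult n x x) y) x"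
      using assms unfolding range_1_18
      by (elim insertE emptyE) (simp_all add: J_mult_simps complex4_eq_iff algebra_simps)
  qed
qed

text \<open>By induction the products that span A^k lie in F k, because F is multiplicative. Hence
  it is enough to exhibit a filtration that reaches 0; no power of the algebra has to be
  computed.\<close>

lemma (in complex_algebra) nilpotent_if_filtration:
  fixes F :: "nat \<Rightarrow> 'a set"
  assumes subsp: "\<And>k. subspace (F k)" and one: "F 1 = UNIV" and N: "N \<ge> 1" "F N = {0}"
    and mult: "\<And>i j x y. x \<in> F i \<Longrightarrow> y \<in> F j \<Longrightarrow> x \<odot> y \<in> F (i + j)"
  shows nilpotent
proof -
  have sub: "k \<ge> 1 \<Longrightarrow> alg_power k \<subseteq> F k" for k
  proof (induction k rule: less_induct)
    case (less k)
    show ?case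
    proof (cases "k = 1")
      case True then show ?thesis using one by simp
    next
      case False
      with less.prems have k: "k \<ge> 2" by simp
      have "{x \<odot> y | x y. \<exists>i\<in>{1..<k}. x \<in> alg_power i \<and> y \<in> alg_power (k - i)} \<subseteq> F k"
      proof clarify
        fix x y i assume i: "i \<in> {1..<k}" and x: "x \<in> alg_power i" and y: "y \<in> alg_power (k - i)"
        have "x \<in> F i" "y \<in> F (k - i)"
          using less.IH[of i] less.IH[of "k - i"] i x y by (auto simp: Suc_le_eq)
        then show "x \<odot> y \<in> F k" using mult[of x i y "k - i"] i by simp
      qed
      then show ?thesis using k by (subst alg_power.simps) (simp add: span_minimal subsp)
    qed
  qed
  have "0 \<in> alg_power N"
    by (subst alg_power.simps) (simp add: span_zero)
  with sub[of N] N have "alg_power N = {0}" by auto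
  with N show ?thesis unfolding nilpotent_def by auto
qed

text \<open>A degree on the basis vectors for which a product has at least the sum of the degrees of
  its factors. In the second and third clauses the two generators get 1, the vector spanning A^2
  modulo A^3 gets 2 and e_4 gets 3.\<close>

definition J_weight :: "nat \<Rightarrow> 4 \<Rightarrow> nat" where
  "J_weight n i =
    (if n \<in> {1, 18} then (if i = 1 then 1 else if i = 2 then 2 else if i = 3 then 3 else 4)
     else if n \<le> 6 then (if i = 2 then 2 else if i = 4 then 3 else 1)
     else (if i = 3 then 2 else if i = 4 then 3 else 1))"

lemma J_table_weight:
  assumes "n \<in> {1..18}" "J_table n (i, j) $ k \<noteq> 0"
  shows "J_weight n i + J_weight n j \<le> J_weight n k"
proof -
  have "\<forall>i j k. J_table n (i, j) $ k \<noteq> 0 \<longrightarrow> J_weight n i + J_weight n j \<le> J_weight n k"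
    using assms(1) unfolding range_1_18
    by (elim insertE emptyE)
      (simp_all add: forall_4 J_table_def J_weight_def axis_def fun_upd_def)
  with assms(2) show ?thesis by blast
qed

lemma nilpotent_J_mult:
  assumes n: "n \<in> {1..18}"
  shows "complex_algebra.nilpotent (*s) (J_mult n)"
proof -
  interpret complex_algebra "(*s)" "J_mult n" by (rule complex_algebra_J_mult)
  \<comment> \<open>F k is spanned by the basis vectors of weight at least k. All weights are at
    most 4, whence F 5 = 0.\<close>
  define F where "F k = {x :: complex ^ 4. \<forall>i. J_weight n i < k \<longrightarrow> x $ i = 0}" for k
  show ?thesis
  proof (rule nilpotent_if_filtration)
    show "vec.subspace (F k)" for k
      by (auto simp: F_def vec.subspace_def)
    show "F 1 = UNIV" by (auto simp: F_def J_weight_def split: if_splits)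
    show "1 \<le> (5::nat)" by simp
    have "J_weight n i < 5" for i by (simp add: J_weight_def)
    then show "F 5 = {0}" by (auto simp: F_def vec_eq_iff)
    fix i j x y assume xy: "x \<in> F i" "y \<in> F j"
    have "x $ p * y $ q * J_table n (p, q) $ k = 0" if k: "J_weight n k < i + j" for p q k
    proof (rule ccontr)
      assume "\<not> ?thesis"
      then have "J_table n (p, q) $ k \<noteq> 0" "\<not> J_weight n p < i" "\<not> J_weight n q < j"
        using xy by (auto simp: F_def)
      with J_table_weight[OF n] k show False by fastforce
    qed
    then show "J_mult n x y \<in> F (i + j)"
      by (auto simp: F_def J_mult_def intro!: sum.neutral)
  qed
qed

lemma nontrivial_J_mult:
  assumes "n \<in> {1..18}"
  shows "complex_algebra.nontrivial (J_mult n)"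
proof -
  interpret complex_algebra "(*s)" "J_mult n" by (rule complex_algebra_J_mult)
  \<comment> \<open>One pair with a(ab) nonzero in all eighteen algebras. In J_02 and J_05 only the
    e_3 component of \<open>a\<close> acts on e_2, so \<open>a\<close> involves e_3 as well.\<close>
  define a where "a = vec4 1 1 1 0"
  define b where "b = vec4 1 0 1 0"
  have "J_mult n a (J_mult n a b) \<noteq> 0"
    using assms unfolding range_1_18
    by (elim insertE emptyE) (simp_all add: J_mult_simps complex4_eq_iff a_def b_def)
  then show ?thesis unfolding nontrivial_def by blast
qed

lemma nontrivial_nilpotent_ncj_dim4_J_mult:
  assumes "n \<in> {1..18}"
  shows "nontrivial_nilpotent_ncj_dim4 (*s) (J_mult n)"
  unfolding nontrivial_nilpotent_ncj_dim4_def
  using noncommutative_jordan_algebra_J_mult[OF assms] nilpotent_J_mult[OF assms]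
    nontrivial_J_mult[OF assms]
  by (simp add: vec_dim_card del: vec.dim_UNIV)

section \<open>An isomorphism-invariant index and its values on the list\<close>

section \<open>Non-isomorphism\<close>

text \<open>Membership in the left annihilator of A^2, called K below. For the first seventeen
  algebras K is the preimage of the line l = 0.\<close>

definition left_kills_products :: "('a::zero \<Rightarrow> 'a \<Rightarrow> 'a) \<Rightarrow> 'a \<Rightarrow> bool" where
  "left_kills_products m x \<longleftrightarrow> (\<forall>u v. m x (m u v) = 0)"

text \<open>A decision tree built from zero, sum and product only. A nonzero fourth power singles
  out J_18; a nonzero cube x(xx) = b(x,x) l(x) w singles out the symmetric forms b. For symmetric b
  the tests ask whether b is nonzero on K, then whether it has a radical vector outside K; if it
  vanishes on K, whether K is orthogonal to the whole plane. Commutativity detects the antisymmetric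
  part of g, and \<open>square\<close> its restriction to K. For alternating b all tests concern the
  symmetrized form g: nonzero on K, degenerate, K in its radical, nonzero at all.\<close>

definition J_index :: "('a::ab_group_add \<Rightarrow> 'a \<Rightarrow> 'a) \<Rightarrow> nat" where
  "J_index m =
    (let comm = (\<forall>x y. m x y = m y x);
         square = (\<exists>x. left_kills_products m x \<and> m x x \<noteq> 0)
     in
     if \<exists>x. m (m (m x x) x) x \<noteq> 0 then 18
     else if \<exists>x. m x (m x x) \<noteq> 0 then
       if \<exists>x y. left_kills_products m x \<and> m (m x x) y \<noteq> 0 then
         if \<exists>x. \<not> left_kills_products m x \<and> (\<forall>y z. m (m x y) z = 0)
         then if comm then 5 else 2
         else if comm then 10 else 7
       else if \<exists>x y z. left_kills_products m x \<and> m (m x y) z \<noteq> 0 then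
         if square then if comm then 12 else 8
         else if comm then 11 else 9
       else if square then if comm then 6 else 3
       else if comm then 1 else 4
     else if square then
       if \<exists>x. \<not> left_kills_products m x \<and> (\<forall>y. m x y + m y x = 0) then 16 else 17
     else if \<exists>x y. left_kills_products m x \<and> m x y + m y x \<noteq> 0 then 15
     else if \<exists>x. m x x \<noteq> 0 then 14
     else 13)"

text \<open>The graph of an isomorphism is a bi-total, bi-unique relation that respects zero, sum
  and product, and the defining formula is made of nothing else, so its value transfers.\<close>

lemma J_index_isomorphic:
  fixes m :: "'a::ab_group_add \<Rightarrow> 'a \<Rightarrow> 'a" and m' :: "'b::ab_group_add \<Rightarrow> 'b \<Rightarrow> 'b"
  assumes "algebra_isomorphic smul m smul' m'"
  shows "J_index m = J_index m'"
proof -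
  obtain f where lin: "Vector_Spaces.linear smul smul' f" and "bij f"
    and mult: "\<And>x y. f (m x y) = m' (f x) (f y)"
    using assms unfolding algebra_isomorphic_def by blast
  interpret Vector_Spaces.linear smul smul' f by (rule lin)
  define R where "R x y \<longleftrightarrow> f x = y" for x y
  have [transfer_rule]: "bi_total R" "bi_unique R"
    using \<open>bij f\<close> by (auto simp: R_def bi_total_def bi_unique_def bij_def surj_def eq_commute dest: injD)
  have [transfer_rule]: "R 0 0" "rel_fun R (rel_fun R R) (+) (+)" "rel_fun R (rel_fun R R) m m'"
    by (auto simp: R_def rel_fun_def add mult zero)
  show ?thesis
    unfolding J_index_def left_kills_products_def Let_def by transfer_prover
qed

text \<open>In each of these algebras the product of a = e_1 and b = e_1 + e_2 has a nonzero
  component on the vector spanning A^2 modulo A^3. The single equation x(ab) = 0 is therefore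
  already the linear equation of the annihilator.\<close>

lemma left_kills_products_J_mult:
  "n \<in> {1, 3, 4, 6, 8, 9, 11, 12, 13, 14, 15, 16, 17} \<Longrightarrow> left_kills_products (J_mult n) x \<longleftrightarrow> x $ 1 = 0"
  "n \<in> {2, 5} \<Longrightarrow> left_kills_products (J_mult n) x \<longleftrightarrow> x $ 3 = 0"
  "n \<in> {7, 10} \<Longrightarrow> left_kills_products (J_mult n) x \<longleftrightarrow> x $ 1 + x $ 2 = 0"
proof -
  define a where "a = vec4 1 0 0 0"
  define b where "b = vec4 1 1 0 0"
  have *: "left_kills_products (J_mult n) x \<Longrightarrow> J_mult n x (J_mult n a b) = 0"
    by (simp add: left_kills_products_def)
  show "n \<in> {1, 3, 4, 6, 8, 9, 11, 12, 13, 14, 15, 16, 17} \<Longrightarrow>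
      left_kills_products (J_mult n) x \<longleftrightarrow> x $ 1 = 0"
    using *
    by (elim insertE emptyE; intro iffI)
      (simp_all add: left_kills_products_def J_mult_simps complex4_eq_iff a_def b_def)
  show "n \<in> {2, 5} \<Longrightarrow> left_kills_products (J_mult n) x \<longleftrightarrow> x $ 3 = 0"
    using *
    by (elim insertE emptyE; intro iffI)
      (simp_all add: left_kills_products_def J_mult_simps complex4_eq_iff a_def b_def)
  show "n \<in> {7, 10} \<Longrightarrow> left_kills_products (J_mult n) x \<longleftrightarrow> x $ 1 + x $ 2 = 0"
    using *
    by (elim insertE emptyE; intro iffI)
      (simp_all add: left_kills_products_def J_mult_simps complex4_eq_iff a_def b_def flip: distrib_right)
qed

lemma fourth_power_J_mult:
  "n \<in> {1..17} \<Longrightarrow> J_mult n (J_mult n (J_mult n x x) x) x = 0"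
  "\<exists>x. J_mult 18 (J_mult 18 (J_mult 18 x x) x) x \<noteq> 0"
proof -
  show "J_mult n (J_mult n (J_mult n x x) x) x = 0" if "n \<in> {1..17}"
  proof -
    from that have "n \<in> {1..18}" "n \<noteq> 18" by auto
    then show ?thesis unfolding range_1_18
      by (elim insertE emptyE) (simp_all add: J_mult_simps complex4_eq_iff algebra_simps)
  qed
  show "\<exists>x. J_mult 18 (J_mult 18 (J_mult 18 x x) x) x \<noteq> 0"
    by (rule exI[of _ "vec4 1 0 0 0"]) (simp add: J_mult_simps complex4_eq_iff)
qed

lemma cube_J_mult:
  "n \<in> {1, 2, 3, 4, 5, 6, 7, 8, 9, 10, 11, 12} \<Longrightarrow> \<exists>x. J_mult n x (J_mult n x x) \<noteq> 0"
  "n \<in> {13, 14, 15, 16, 17} \<Longrightarrow> J_mult n x (J_mult n x x) = 0"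
  by (rule exI[of _ "vec4 1 1 1 0"], elim insertE emptyE)
    (auto simp: J_mult_simps complex4_eq_iff algebra_simps)

lemma commutative_J_mult:
  "n \<in> {1, 5, 6, 10, 11, 12} \<Longrightarrow> J_mult n x y = J_mult n y x"
  "n \<in> {2, 3, 4, 7, 8, 9} \<Longrightarrow> \<exists>x y. J_mult n x y \<noteq> J_mult n y x"
proof -
  show "n \<in> {1, 5, 6, 10, 11, 12} \<Longrightarrow> J_mult n x y = J_mult n y x"
    by (elim insertE emptyE) (simp_all add: J_mult_simps complex4_eq_iff algebra_simps)
  show "n \<in> {2, 3, 4, 7, 8, 9} \<Longrightarrow> \<exists>x y. J_mult n x y \<noteq> J_mult n y x"
    by (rule exI[of _ "vec4 1 0 0 0"], rule exI[of _ "vec4 0 1 1 0"], elim insertE emptyE)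
      (simp_all add: J_mult_simps complex4_eq_iff)
qed

lemma square_times_J_mult:
  "n \<in> {2, 5, 7, 10} \<Longrightarrow> \<exists>x y. left_kills_products (J_mult n) x \<and> J_mult n (J_mult n x x) y \<noteq> 0"
  "n \<in> {1, 3, 4, 6, 8, 9, 11, 12} \<Longrightarrow> left_kills_products (J_mult n) x \<Longrightarrow> J_mult n (J_mult n x x) y = 0"
proof -
  show "n \<in> {2, 5, 7, 10} \<Longrightarrow> \<exists>x y. left_kills_products (J_mult n) x \<and> J_mult n (J_mult n x x) y \<noteq> 0"
    \<comment> \<open>e_1 - e_2 satisfies both equations of the annihilator that occur here, x_3 = 0
      and x_1 + x_2 = 0.\<close>
    by (rule exI[of _ "vec4 1 (-1) 0 0"], rule exI[of _ "vec4 1 0 1 0"], elim insertE emptyE)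
      (simp_all add: left_kills_products_J_mult J_mult_simps complex4_eq_iff)
  show "n \<in> {1, 3, 4, 6, 8, 9, 11, 12} \<Longrightarrow> left_kills_products (J_mult n) x \<Longrightarrow>
      J_mult n (J_mult n x x) y = 0"
    by (elim insertE emptyE)
      (simp_all add: left_kills_products_J_mult left_kills_products_J_mult(1)[of "Suc 0"] J_mult_simps complex4_eq_iff)
qed

lemma degenerate_J_mult:
  "n \<in> {2, 5} \<Longrightarrow> \<exists>x. \<not> left_kills_products (J_mult n) x \<and> (\<forall>y z. J_mult n (J_mult n x y) z = 0)"
  "n \<in> {7, 10} \<Longrightarrow> \<forall>y z. J_mult n (J_mult n x y) z = 0 \<Longrightarrow> left_kills_products (J_mult n) x"
proof -
  show "n \<in> {2, 5} \<Longrightarrow>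
      \<exists>x. \<not> left_kills_products (J_mult n) x \<and> (\<forall>y z. J_mult n (J_mult n x y) z = 0)"
    by (rule exI[of _ "vec4 0 0 1 0"], elim insertE emptyE)
      (simp_all add: left_kills_products_J_mult J_mult_simps complex4_eq_iff)
  assume n: "n \<in> {7, 10}" and "\<forall>y z. J_mult n (J_mult n x y) z = 0"
  \<comment> \<open>In J_07 and J_10 the form b is nondegenerate: multiplying by e_1 and by e_2
    extracts the coordinates x_2 and x_1, and the outer factor e_1 carries e_3 to e_4.\<close>
  then have "J_mult n (J_mult n x (vec4 1 0 0 0)) (vec4 1 0 0 0) = 0"
    "J_mult n (J_mult n x (vec4 0 1 0 0)) (vec4 1 0 0 0) = 0" by auto
  with n show "left_kills_products (J_mult n) x"
    by (elim insertE emptyE)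
      (simp_all add: left_kills_products_J_mult J_mult_simps complex4_eq_iff)
qed

lemma product_times_J_mult:
  "n \<in> {8, 9, 11, 12} \<Longrightarrow>
    \<exists>x y z. left_kills_products (J_mult n) x \<and> J_mult n (J_mult n x y) z \<noteq> 0"
  "n \<in> {1, 3, 4, 6} \<Longrightarrow> left_kills_products (J_mult n) x \<Longrightarrow> J_mult n (J_mult n x y) z = 0"
proof -
  show "n \<in> {8, 9, 11, 12} \<Longrightarrow>
      \<exists>x y z. left_kills_products (J_mult n) x \<and> J_mult n (J_mult n x y) z \<noteq> 0"
    by (rule exI[of _ "vec4 0 1 0 0"], rule exI[of _ "vec4 1 0 0 0"], rule exI[of _ "vec4 1 0 0 0"],
        elim insertE emptyE)
      (simp_all add: left_kills_products_J_mult J_mult_simps complex4_eq_iff)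
  show "n \<in> {1, 3, 4, 6} \<Longrightarrow> left_kills_products (J_mult n) x \<Longrightarrow> J_mult n (J_mult n x y) z = 0"
    by (elim insertE emptyE)
      (simp_all add: left_kills_products_J_mult left_kills_products_J_mult(1)[of "Suc 0"] J_mult_simps complex4_eq_iff)
qed

lemma square_J_mult:
  "n \<in> {3, 6, 8, 12, 16, 17} \<Longrightarrow> \<exists>x. left_kills_products (J_mult n) x \<and> J_mult n x x \<noteq> 0"
  "n \<in> {1, 4, 9, 11, 13, 14, 15} \<Longrightarrow> left_kills_products (J_mult n) x \<Longrightarrow> J_mult n x x = 0"
proof -
  show "n \<in> {3, 6, 8, 12, 16, 17} \<Longrightarrow> \<exists>x. left_kills_products (J_mult n) x \<and> J_mult n x x \<noteq> 0"
    by (rule exI[of _ "vec4 0 1 1 0"], elim insertE emptyE)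
      (simp_all add: left_kills_products_J_mult J_mult_simps complex4_eq_iff)
  show "n \<in> {1, 4, 9, 11, 13, 14, 15} \<Longrightarrow> left_kills_products (J_mult n) x \<Longrightarrow> J_mult n x x = 0"
    by (elim insertE emptyE)
      (simp_all add: left_kills_products_J_mult left_kills_products_J_mult(1)[of "Suc 0"] J_mult_simps complex4_eq_iff)
qed

lemma anticommutator_J_mult:
  "\<exists>x. \<not> left_kills_products (J_mult 16) x \<and> (\<forall>y. J_mult 16 x y + J_mult 16 y x = 0)"
  "\<forall>y. J_mult 17 x y + J_mult 17 y x = 0 \<Longrightarrow> left_kills_products (J_mult 17) x"
  "\<exists>x y. left_kills_products (J_mult 15) x \<and> J_mult 15 x y + J_mult 15 y x \<noteq> 0"
  "n \<in> {13, 14} \<Longrightarrow> left_kills_products (J_mult n) x \<Longrightarrow> J_mult n x y + J_mult n y x = 0"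
proof -
  show "\<exists>x. \<not> left_kills_products (J_mult 16) x \<and> (\<forall>y. J_mult 16 x y + J_mult 16 y x = 0)"
    by (rule exI[of _ "vec4 1 0 0 0"]) (simp add: left_kills_products_J_mult J_mult_simps complex4_eq_iff)
  show "\<exists>x y. left_kills_products (J_mult 15) x \<and> J_mult 15 x y + J_mult 15 y x \<noteq> 0"
    by (rule exI[of _ "vec4 0 1 0 0"], rule exI[of _ "vec4 1 0 0 0"])
      (simp add: left_kills_products_J_mult J_mult_simps complex4_eq_iff)
  show "n \<in> {13, 14} \<Longrightarrow> left_kills_products (J_mult n) x \<Longrightarrow> J_mult n x y + J_mult n y x = 0"
    by (elim insertE emptyE) (simp_all add: left_kills_products_J_mult J_mult_simps complex4_eq_iff)
  assume "\<forall>y. J_mult 17 x y + J_mult 17 y x = 0"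
  then have "J_mult 17 x (vec4 1 0 0 0) + J_mult 17 (vec4 1 0 0 0) x = 0" by blast
  then show "left_kills_products (J_mult 17) x"
    by (simp add: left_kills_products_J_mult J_mult_simps complex4_eq_iff)
qed

lemma square_J_mult_13_14:
  "J_mult 13 x x = 0" "\<exists>x. J_mult 14 x x \<noteq> 0"
  by (simp add: J_mult_simps complex4_eq_iff)
    (rule exI[of _ "vec4 1 0 0 0"], simp add: J_mult_simps complex4_eq_iff)

lemma J_index_J_mult:
  assumes "n \<in> {1..18}"
  shows "J_index (J_mult n) = n"
proof (cases "n = 18")
  case True
  then show ?thesis using fourth_power_J_mult(2) by (simp add: J_index_def)
next
  case False
  with assms have n: "n \<in> {1..17}" by auto
  \<comment> \<open>The groups follow the tree: symmetric b vanishing on K, symmetric b nonzero on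
    K, and the branches for alternating b.\<close>
  have range_1_17: "n \<in> {1, 3, 4, 6, 8, 9, 11, 12} \<or> n \<in> {2, 5, 7, 10} \<or>
      n \<in> {13, 14} \<or> n = 15 \<or> n \<in> {16, 17}"
    using n by (simp, presburger)
  have four: "\<not> (\<exists>x. J_mult n (J_mult n (J_mult n x x) x) x \<noteq> 0)"
    using fourth_power_J_mult(1)[OF n] by simp
  consider (a) "n \<in> {1, 3, 4, 6, 8, 9, 11, 12}" | (b) "n \<in> {2, 5, 7, 10}"
    | (c) "n \<in> {13, 14}" | (d) "n = 15" | (e) "n \<in> {16, 17}"
    using range_1_17 by argo
  then show ?thesis
  proof cases
    case a
    then have "n \<in> {1, 5, 6, 10, 11, 12} \<or> n \<in> {2, 3, 4, 7, 8, 9}"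
      and "n \<in> {8, 9, 11, 12} \<or> n \<in> {1, 3, 4, 6}"
      and "n \<in> {3, 6, 8, 12, 16, 17} \<or> n \<in> {1, 4, 9, 11, 13, 14, 15}"
      and cube: "n \<in> {1, 2, 3, 4, 5, 6, 7, 8, 9, 10, 11, 12}" by auto
    then have comm: "(\<forall>x y. J_mult n x y = J_mult n y x) \<longleftrightarrow> n \<in> {1, 5, 6, 10, 11, 12}"
      and prod: "(\<exists>x y z. left_kills_products (J_mult n) x \<and> J_mult n (J_mult n x y) z \<noteq> 0) \<longleftrightarrow>
        n \<in> {8, 9, 11, 12}"
      and square: "(\<exists>x. left_kills_products (J_mult n) x \<and> J_mult n x x \<noteq> 0) \<longleftrightarrow> n \<in> {3, 6, 8, 12, 16, 17}"
      using commutative_J_mult[of n] product_times_J_mult[of n] square_J_mult[of n] by metis+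
    have times: "\<not> (\<exists>x y. left_kills_products (J_mult n) x \<and> J_mult n (J_mult n x x) y \<noteq> 0)"
      using square_times_J_mult(2)[OF a] by blast
    show ?thesis
      unfolding J_index_def Let_def if_not_P[OF four] if_P[OF cube_J_mult(1)[OF cube]]
        if_not_P[OF times] comm prod square
      using a by auto
  next
    case b
    then have "n \<in> {1, 5, 6, 10, 11, 12} \<or> n \<in> {2, 3, 4, 7, 8, 9}"
      and "n \<in> {2, 5} \<or> n \<in> {7, 10}"
      and cube: "n \<in> {1, 2, 3, 4, 5, 6, 7, 8, 9, 10, 11, 12}" by auto
    then have comm: "(\<forall>x y. J_mult n x y = J_mult n y x) \<longleftrightarrow> n \<in> {1, 5, 6, 10, 11, 12}"
      and degenerate: "(\<exists>x. \<not> left_kills_products (J_mult n) x \<and> (\<forall>y z. J_mult n (J_mult n x y) z = 0)) \<longleftrightarrow>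
        n \<in> {2, 5}"
      using commutative_J_mult[of n] degenerate_J_mult[of n] by metis+
    show ?thesis
      unfolding J_index_def Let_def if_not_P[OF four] if_P[OF cube_J_mult(1)[OF cube]]
        if_P[OF square_times_J_mult(1)[OF b]] comm degenerate
      using b by auto
  next
    case c
    then have cube: "\<not> (\<exists>x. J_mult n x (J_mult n x x) \<noteq> 0)"
      and square: "\<not> (\<exists>x. left_kills_products (J_mult n) x \<and> J_mult n x x \<noteq> 0)"
      using cube_J_mult(2)[of n] square_J_mult(2)[of n] by blast+
    have anti: "\<not> (\<exists>x y. left_kills_products (J_mult n) x \<and> J_mult n x y + J_mult n y x \<noteq> 0)"
      using anticommutator_J_mult(4)[OF c] by blast
    have "(\<exists>x. J_mult n x x \<noteq> 0) \<longleftrightarrow> n = 14"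
      using c square_J_mult_13_14 by auto
    then show ?thesis
      unfolding J_index_def Let_def if_not_P[OF four] if_not_P[OF cube] if_not_P[OF square]
        if_not_P[OF anti]
      using c by auto
  next
    case d
    then have cube: "\<not> (\<exists>x. J_mult n x (J_mult n x x) \<noteq> 0)"
      and square: "\<not> (\<exists>x. left_kills_products (J_mult n) x \<and> J_mult n x x \<noteq> 0)"
      and anti: "\<exists>x y. left_kills_products (J_mult n) x \<and> J_mult n x y + J_mult n y x \<noteq> 0"
      using cube_J_mult(2)[of n] square_J_mult(2)[of n] anticommutator_J_mult(3) by blast+
    show ?thesis
      unfolding J_index_def Let_def if_not_P[OF four] if_not_P[OF cube] if_not_P[OF square]
        if_P[OF anti]
      using d by simp
  next
    case e
    then have cube: "\<not> (\<exists>x. J_mult n x (J_mult n x x) \<noteq> 0)"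
      and square: "\<exists>x. left_kills_products (J_mult n) x \<and> J_mult n x x \<noteq> 0"
      using cube_J_mult(2)[of n] square_J_mult(1)[of n] by blast+
    have anti: "(\<exists>x. \<not> left_kills_products (J_mult n) x \<and> (\<forall>y. J_mult n x y + J_mult n y x = 0)) \<longleftrightarrow> n = 16"
      using e anticommutator_J_mult(1,2) by auto
    show ?thesis
      unfolding J_index_def Let_def if_not_P[OF four] if_not_P[OF cube] if_P[OF square] anti
      using e by auto
  qed
qed

section \<open>Coordinates, the lower central series, and algebras whose A/A^2 is a line\<close>

section \<open>The lower series and the one-generated case\<close>

text \<open>Dimension 4 is first turned into an explicit basis of the target, finite because
  infinite sets have cardinality 0. Then surjectivity between spaces of equal finite dimension gives
  injectivity.\<close>

lemma surj_linear_same_dim_bij: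
  fixes g :: "complex ^ 4 \<Rightarrow> 'a::ab_group_add"
  assumes "Vector_Spaces.linear (*s) smul g" "surj g" "vector_space.dim smul (UNIV :: 'a set) = 4"
  shows "bij g"
proof -
  interpret Vector_Spaces.linear "(*s)" smul g by fact
  obtain B where B: "vs2.independent B" "vs2.span B = UNIV" "card B = 4"
    using vs2.basis_exists[of UNIV] assms(3) by (metis top.extremum_uniqueI)
  have "finite B" using B(3) card.infinite by fastforce
  with B interpret W: finite_dimensional_vector_space smul B
    by unfold_locales auto
  interpret finite_dimensional_vector_space_pair "(*s)" "cart_basis :: (complex ^ 4) set" smul B ..
  have "inj g"
    using linear_surjective_imp_injective[OF assms(1,2)] assms(3) by (simp add: vec_dim_card B del: vec.dim_UNIV W.dim_UNIV)
  with assms(2) show ?thesis by (simp add: bij_def)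
qed

definition quad :: "'a \<Rightarrow> 'a \<Rightarrow> 'a \<Rightarrow> 'a \<Rightarrow> 4 \<Rightarrow> 'a" where
  "quad e1 e2 e3 e4 i = (if i = 1 then e1 else if i = 2 then e2 else if i = 3 then e3 else e4)"

lemma quad_simps [simp]:
  "quad e1 e2 e3 e4 1 = e1" "quad e1 e2 e3 e4 2 = e2" "quad e1 e2 e3 e4 3 = e3" "quad e1 e2 e3 e4 4 = e4"
  by (simp_all add: quad_def)

context complex_algebra
begin

lemma mult_zero_left [simp]: "0 \<odot> x = 0"
  using mult_add_left[of 0 0 x] by simp

lemma mult_zero_right [simp]: "x \<odot> 0 = 0"
  using mult_add_right[of x 0 0] by simp

lemma mult_sum_left: "(\<Sum>i\<in>I. f i) \<odot> x = (\<Sum>i\<in>I. f i \<odot> x)"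
  by (induction I rule: infinite_finite_induct) (simp_all add: mult_add_left)

lemma mult_sum_right: "x \<odot> (\<Sum>i\<in>I. f i) = (\<Sum>i\<in>I. x \<odot> f i)"
  by (induction I rule: infinite_finite_induct) (simp_all add: mult_add_right)

text \<open>In dimension 4 it is enough that the four vectors span: the coordinate map from C^4 is
  onto, hence bijective, and it is multiplicative because it is so on basis vectors. The isomorphism
  is its inverse. All products form one quantified formula, which \<open>forall_4\<close> unfolds
  into sixteen equations.\<close>

lemma isomorphic_if_basis:
  assumes dim: "dim UNIV = 4" and span4: "span {e1, e2, e3, e4} = UNIV"
    and e: "e = quad e1 e2 e3 e4"
    and mult': "\<forall>i j. e i \<odot> e j = (\<Sum>k\<in>UNIV. smul (J_table n (i, j) $ k) (e k))"
  shows "algebra_isomorphic smul (\<odot>) (*s) (J_mult n)"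
proof -
  have mult: "e i \<odot> e j = (\<Sum>k\<in>UNIV. smul (J_table n (i, j) $ k) (e k))" for i j
    using mult' by blast
  have span: "span (range e) = UNIV"
    using span4 by (simp add: e UNIV_4)
  define g where "g v = (\<Sum>i\<in>UNIV. smul (v $ i) (e i))" for v :: "complex ^ 4"
  interpret g: Vector_Spaces.linear "(*s)" smul g
    by unfold_locales
      (simp_all add: g_def scale_left_distrib sum.distrib scale_sum_right)
  have "range g = UNIV"
  proof -
    have "e i \<in> range g" for i
      by (rule range_eqI[of _ _ "axis i 1"]) (simp add: g_def axis_def if_distrib[of "\<lambda>c. smul c _"] cong: if_cong)
    then have "span (range e) \<subseteq> range g"
      by (intro span_minimal) (auto intro: g.subspace_image)
    with span show ?thesis by auto
  qed
  then have "bij g"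
    using surj_linear_same_dim_bij[OF g.linear_axioms] dim by simp
  have gmult: "g (J_mult n x y) = g x \<odot> g y" for x y
  proof -
    have "g (J_mult n x y) = (\<Sum>i\<in>UNIV. \<Sum>j\<in>UNIV. smul (x $ i * y $ j) (g (J_table n (i, j))))"
      by (simp add: J_mult_def g.sum g.scale)
    also have "\<dots> = (\<Sum>i\<in>UNIV. \<Sum>j\<in>UNIV. smul (x $ i * y $ j) (e i \<odot> e j))"
      by (simp add: mult g_def)
    also have "\<dots> = g x \<odot> g y"
      unfolding g_def mult_sum_left unfolding mult_sum_right
      by (simp add: mult_scale_left mult_scale_right mult.commute)
    finally show ?thesis .
  qed
  have "Vector_Spaces.linear smul (*s) (inv g)"
  proof -
    have "inv g (x + y) = inv g x + inv g y" for x y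
      by (metis \<open>bij g\<close> bij_inv_eq_iff g.add)
    moreover have "inv g (smul c x) = c *s inv g x" for c x
      by (metis \<open>bij g\<close> bij_inv_eq_iff g.scale)
    ultimately show ?thesis by unfold_locales auto
  qed
  moreover have "inv g (x \<odot> y) = J_mult n (inv g x) (inv g y)" for x y
    by (metis \<open>bij g\<close> bij_inv_eq_iff gmult)
  ultimately show ?thesis
    unfolding algebra_isomorphic_def using bij_imp_bij_inv[OF \<open>bij g\<close>] by blast
qed

lemma span_mult:
  assumes "a \<in> span S" "b \<in> span T" "subspace U" and *: "\<And>s t. s \<in> S \<Longrightarrow> t \<in> T \<Longrightarrow> s \<odot> t \<in> U"
  shows "a \<odot> b \<in> U"
proof -
  have "s \<odot> b \<in> U" if "s \<in> S" for s
    using \<open>b \<in> span T\<close>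
    by (induction rule: span_induct_alt)
      (auto simp: mult_add_right mult_scale_right assms * that
        intro!: subspace_add subspace_scale subspace_0)
  with \<open>a \<in> span S\<close> show ?thesis
    by (induction rule: span_induct_alt)
      (auto simp: mult_add_left mult_scale_left assms intro!: subspace_add subspace_scale subspace_0)
qed

(* lower_series k is A^(k+1); the index is shifted by one against alg_power. *)
primrec lower_series :: "nat \<Rightarrow> 'a set" where
  "lower_series 0 = UNIV"
| "lower_series (Suc k) =
    span ({a \<odot> x | a x. x \<in> lower_series k} \<union> {x \<odot> a | a x. x \<in> lower_series k})"

declare lower_series.simps(2) [simp del]

lemma subspace_lower_series [simp]: "subspace (lower_series k)"
  by (cases k) (auto simp: lower_series.simps(2))

lemma mult_lower_series:
  "x \<in> lower_series k \<Longrightarrow> a \<odot> x \<in> lower_series (Suc k)"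
  "x \<in> lower_series k \<Longrightarrow> x \<odot> a \<in> lower_series (Suc k)"
  unfolding lower_series.simps(2) by (rule span_base, blast)+

lemma lower_series_Suc_minimal:
  assumes "subspace U" "\<And>a x. x \<in> lower_series k \<Longrightarrow> a \<odot> x \<in> U"
    "\<And>a x. x \<in> lower_series k \<Longrightarrow> x \<odot> a \<in> U"
  shows "lower_series (Suc k) \<subseteq> U"
  unfolding lower_series.simps(2) using assms by (intro span_minimal) auto

lemma lower_series_Suc_subset: "lower_series (Suc k) \<subseteq> lower_series k"
proof (induction k)
  case (Suc k)
  then show ?case
    by (intro lower_series_Suc_minimal) (auto intro: mult_lower_series)
qed simp

lemma lower_series_antimono: "i \<le> j \<Longrightarrow> lower_series j \<subseteq> lower_series i"
  by (rule lift_Suc_antimono_le[of lower_series]) (rule lower_series_Suc_subset)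

text \<open>A^(k+2) contains the products of A^1 and A^(k+1) in either order, the splittings i = 1
  and i = k + 1. Through this inclusion nilpotency carries over to the lower series.\<close>

lemma lower_series_subset_alg_power: "lower_series k \<subseteq> alg_power (Suc k)"
proof (induction k)
  case 0
  then show ?case by (simp add: alg_power.simps)
next
  case (Suc k)
  have one: "alg_power (Suc 0) = UNIV" by (simp add: alg_power.simps)
  have "a \<odot> x \<in> alg_power (Suc (Suc k)) \<and> x \<odot> a \<in> alg_power (Suc (Suc k))"
    if "x \<in> lower_series k" for a x
  proof -
    have x: "x \<in> alg_power (Suc k)" using Suc.IH that by blast
    show ?thesis
    proof
      have "\<exists>i\<in>{1..<Suc (Suc k)}. a \<in> alg_power i \<and> x \<in> alg_power (Suc (Suc k) - i)"
        using x one by (intro bexI[of _ "Suc 0"]) auto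
      then show "a \<odot> x \<in> alg_power (Suc (Suc k))"
        by (subst alg_power.simps) (auto intro: span_base)
      have "\<exists>i\<in>{1..<Suc (Suc k)}. x \<in> alg_power i \<and> a \<in> alg_power (Suc (Suc k) - i)"
        using x one by (intro bexI[of _ "Suc k"]) auto
      then show "x \<odot> a \<in> alg_power (Suc (Suc k))"
        by (subst alg_power.simps) (auto intro: span_base)
    qed
  qed
  moreover have "subspace (alg_power (Suc (Suc k)))"
    by (subst alg_power.simps) simp
  ultimately show ?case by (intro lower_series_Suc_minimal) auto
qed

text \<open>Each term is determined by its predecessor, so a repetition makes the series constant
  from there on. By the index shift the term number K - 1 lies in A^K = 0.\<close>

lemma lower_series_stationary:
  assumes nilpotent "lower_series (Suc k) = lower_series k"
  shows "lower_series k = {0}"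
proof -
  have const: "lower_series (k + m) = lower_series k" for m
    using assms(2) by (induction m) (auto simp: lower_series.simps(2))
  obtain K where K: "K \<ge> 1" "alg_power K = {0}"
    using assms(1) nilpotent_def by auto
  have "lower_series (k + K) \<subseteq> lower_series (K - 1)"
    by (rule lower_series_antimono) simp
  also have "\<dots> \<subseteq> {0}"
    using lower_series_subset_alg_power[of "K - 1"] K by simp
  finally show ?thesis using const[of K] subspace_0[OF subspace_lower_series, of k] by auto
qed

end

text \<open>The basis is a parameter in order to have the dimension theory of finite-dimensional
  spaces at hand; \<open>isomorphic_J_mult_if_ncj4\<close> obtains one from the dimension.\<close>

locale nilpotent_ncj4 =
  noncommutative_jordan_algebra smul amul + finite_dimensional_vector_space smul Basis
  for smul :: "complex \<Rightarrow> 'a::ab_group_add \<Rightarrow> 'a" and amul (infixl "\<odot>" 70) and Basis +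
  assumes dim_4: "dim (UNIV :: 'a set) = 4" and nilp: nilpotent and nontriv: nontrivial
begin

lemma dim_lower_series_less:
  assumes "lower_series k \<noteq> {0}"
  shows "dim (lower_series (Suc k)) < dim (lower_series k)"
proof -
  have "lower_series (Suc k) \<subset> lower_series k"
    using assms lower_series_Suc_subset[of k] lower_series_stationary[OF nilp, of k] by blast
  then show ?thesis
    by (intro dim_psubset) (metis span_eq_iff subspace_lower_series)
qed

lemma lower_series_eq_0: "dim (lower_series k) \<le> 1 \<Longrightarrow> lower_series (Suc k) = {0}"
proof -
  assume "dim (lower_series k) \<le> 1"
  then have "lower_series k = {0} \<or> dim (lower_series (Suc k)) = 0"
    using dim_lower_series_less[of k] by fastforce
  then have "lower_series (Suc k) \<subseteq> {0}"
    using lower_series_Suc_subset[of k] by auto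
  then show ?thesis using subspace_0[OF subspace_lower_series, of "Suc k"] by blast
qed

text \<open>Polarization of flexibility in its repeated variable.\<close>

lemma flexible_linearized: "x \<odot> (y \<odot> z) + z \<odot> (y \<odot> x) = (x \<odot> y) \<odot> z + (z \<odot> y) \<odot> x"
  using flexible[of "x + z" y] flexible[of x y] flexible[of z y]
  by (simp add: mult_add_left mult_add_right algebra_simps)

text \<open>The terms are A^2 and A^3. Nontriviality makes A^3 nonzero; A^2 is smaller than A by
  nilpotency, and dimension at most 1 for A^2 would force A^3 = 0.\<close>

lemma dim_lower_series:
  "dim (lower_series 1) \<in> {2, 3}" "lower_series 2 \<noteq> {0}"
proof -
  show L2: "lower_series 2 \<noteq> {0}"
  proof
    assume *: "lower_series 2 = {0}"
    have "(x \<odot> y) \<odot> z = 0 \<and> x \<odot> (y \<odot> z) = 0" for x y z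
    proof -
      have "(x \<odot> y) \<odot> z \<in> lower_series (Suc (Suc 0))" "x \<odot> (y \<odot> z) \<in> lower_series (Suc (Suc 0))"
        by (intro mult_lower_series; simp)+
      then show ?thesis using * by (simp add: numeral_2_eq_2)
    qed
    with nontriv show False unfolding nontrivial_def by blast
  qed
  have "dim (lower_series (Suc 0)) < 4"
    using dim_lower_series_less[of 0] dim_4 by (metis dim_eq_0 lower_series.simps(1) less_numeral_extra(3) subset_refl zero_less_numeral)
  moreover have "\<not> dim (lower_series 1) \<le> 1"
    using lower_series_eq_0[of 1] L2 by (auto simp: numeral_2_eq_2)
  ultimately show "dim (lower_series 1) \<in> {2, 3}" by auto
qed

lemma span_insert_eq_UNIV:
  assumes "dim S = 3" "x \<notin> span S"
  shows "span (insert x S) = UNIV"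
  using assms dim_4 subspace_dim_equal[of "span (insert x S)" UNIV] by (simp add: dim_insert)

text \<open>A = Cx + A^2 for any x outside A^2. Multiplying out such decompositions shows that each
  A^k is spanned by the k-th power of x modulo A^(k+1), so four powers of x form a basis. The
  identities determine the products of these powers.\<close>

lemma isomorphic_J_18:
  assumes dim3: "dim (lower_series 1) = 3"
  shows "algebra_isomorphic smul (\<odot>) (*s) (J_mult 18)"
proof -
  define L where "L = lower_series"
  have LS: "subspace (L k)" "span (L k) = L k" for k
    by (simp_all add: L_def)
  have mL: "y \<in> L k \<Longrightarrow> a \<odot> y \<in> L (Suc k)" "y \<in> L k \<Longrightarrow> y \<odot> a \<in> L (Suc k)" for y k a
    unfolding L_def by (rule mult_lower_series; assumption)+
  have "L 1 \<noteq> UNIV" using dim3 dim_4 by (metis L_def numeral_eq_iff semiring_norm(88))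
  then obtain x where x: "x \<notin> L 1" by blast
  define x2 where "x2 = x \<odot> x"
  define x3 where "x3 = x \<odot> x2"
  define x4 where "x4 = x \<odot> x3"
  \<comment> \<open>Flexibility makes left and right multiplication by x agree on \<open>x2\<close>
    and \<open>x3\<close>; the Jordan identity at y = x gives the square of
    \<open>x2\<close>.\<close>
  have x3': "x2 \<odot> x = x3" using flexible[of x x] by (simp add: x3_def x2_def)
  have x4': "x3 \<odot> x = x4" using flexible[of x x2] by (simp add: x4_def x3' flip: x3_def)
  have x4'': "x2 \<odot> x2 = x4" using jordan[of x x] x3' x4' by (simp flip: x2_def)
  have U: "span (insert x (L 1)) = UNIV"
    using x dim3 by (intro span_insert_eq_UNIV) (simp add: L_def, simp add: LS)
  have in_L: "x2 \<in> L 1" "x3 \<in> L 2" "x4 \<in> L 3"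
    using mL[of x 0 x] mL[of x2 1 x] mL[of x3 2 x]
    by (auto simp: x2_def x3_def x4_def L_def numeral_eq_Suc)
  have L1: "L 1 \<subseteq> span (insert x2 (L 2))"
  proof -
    have "a \<odot> b \<in> span (insert x2 (L 2))" for a b
    proof (rule span_mult)
      show "a \<in> span (insert x (L 1))" "b \<in> span (insert x (L 1))" by (simp_all only: U UNIV_I)
      fix s t assume "s \<in> insert x (L 1)" "t \<in> insert x (L 1)"
      then have "s \<odot> t \<in> insert x2 (L 2)"
        using mL[of s 1 t] mL[of t 1 s] by (auto simp: x2_def numeral_2_eq_2)
      then show "s \<odot> t \<in> span (insert x2 (L 2))" by (rule span_base)
    qed auto
    then show ?thesis unfolding L_def One_nat_def by (intro lower_series_Suc_minimal) auto
  qed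
  have "insert x (L 1) \<subseteq> span (insert x (insert x2 (L 2)))"
    using L1 span_mono[of "insert x2 (L 2)" "insert x (insert x2 (L 2))"]
    by (auto intro: span_base)
  then have "span (insert x (L 1)) \<subseteq> span (insert x (insert x2 (L 2)))"
    by (intro span_minimal) auto
  then have U2: "span (insert x (insert x2 (L 2))) = UNIV"
    using U by auto
  \<comment> \<open>Besides the products of x and \<open>x2\<close>, which are \<open>x3\<close>,
    everything falls into A^4, including the square of \<open>x2\<close>.\<close>
  have L2: "L 2 \<subseteq> span (insert x3 (L 3))"
  proof -
    have "a \<odot> b \<in> span (insert x3 (L 3)) \<and> b \<odot> a \<in> span (insert x3 (L 3))" if "b \<in> L 1" for a b
    proof -
      have a: "a \<in> span (insert x (insert x2 (L 2)))" and b: "b \<in> span (insert x2 (L 2))"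
        using U2 L1 that by auto
      have *: "s \<odot> t \<in> span (insert x3 (L 3))" "t \<odot> s \<in> span (insert x3 (L 3))"
        if "s \<in> insert x (insert x2 (L 2))" "t \<in> insert x2 (L 2)" for s t
      proof -
        have "s \<odot> t \<in> insert x3 (L 3)" "t \<odot> s \<in> insert x3 (L 3)"
          using that in_L x3' x4'' mL[of s 2 t] mL[of t 2 s]
          by (auto simp: numeral_3_eq_3 numeral_2_eq_2 simp flip: x3_def)
        then show "s \<odot> t \<in> span (insert x3 (L 3))" "t \<odot> s \<in> span (insert x3 (L 3))"
          by (simp_all add: span_base)
      qed
      show ?thesis using span_mult[OF a b _ *(1)] span_mult[OF b a _ *(2)] by simp
    qed
    then show ?thesis unfolding L_def numeral_2_eq_2 One_nat_def
      by (intro lower_series_Suc_minimal) auto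
  qed
  \<comment> \<open>Dimensions drop strictly, and by the inclusions above by at most one, so they
    run through 3, 2, 1, 0.\<close>
  have dims: "dim (L (Suc k)) < dim (L k)" if "dim (L k) > 0" for k
    using dim_lower_series_less[of k] that unfolding L_def by (metis dim_eq_0 less_irrefl order_refl)
  have "dim (L 1) \<le> Suc (dim (L 2))"
    using dim_subset[OF L1] by (simp add: dim_insert split: if_splits)
  then have d2: "dim (L 2) = 2"
    using dims[of 1] dim3 by (simp add: L_def numeral_2_eq_2)
  have "dim (L 2) \<le> Suc (dim (L 3))"
    using dim_subset[OF L2] by (simp add: dim_insert split: if_splits)
  then have d3: "dim (L 3) = 1"
    using dims[of 2] d2 by (simp add: numeral_3_eq_3 numeral_2_eq_2)
  have L4: "L 4 = {0}"
    using lower_series_eq_0[of 3] d3 by (simp add: L_def numeral_eq_Suc)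
  have ann: "a \<odot> c = 0" "c \<odot> a = 0" if "c \<in> L 3" for a c
    using mL[OF that, of a] L4 by (auto simp: numeral_eq_Suc)
  \<comment> \<open>With y = \<open>x2\<close> the Jordan identity becomes x2 x3 = x4 x, and A^4
    annihilates everything.\<close>
  have x23: "x2 \<odot> x3 = 0"
    using jordan[of x x2] ann in_L x4'' x3' by (simp flip: x2_def)
  have x32: "x3 \<odot> x2 = 0"
    using flexible_linearized[of x x2 x2] ann in_L x4'' x3' x23
    by (simp flip: x3_def)
  have x33: "x3 \<odot> x3 = 0"
  proof -
    (* the Jordan identity for x + x2 and x2 *)
    have "(x + x2) \<odot> (x + x2) = x2 + x3 + x3 + x4"
      using x3' x4'' by (simp add: mult_add_left mult_add_right flip: x2_def x3_def)
    then have "(x2 + x3 + x3 + x4) \<odot> (x2 \<odot> (x + x2)) = (x2 + x3 + x3 + x4) \<odot> x2 \<odot> (x + x2)"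
      using jordan[of "x + x2" x2] by simp
    \<comment> \<open>Expanded, the left side is twice the square of \<open>x3\<close>, and the
      right side is x4 (x + x2) = 0.\<close>
    then have "x3 \<odot> x3 + x3 \<odot> x3 = 0"
      using x3' x4'' ann in_L x23 x32 by (simp add: mult_add_left mult_add_right)
    then have "smul 2 (x3 \<odot> x3) = 0"
      using scale_left_distrib[of 1 1 "x3 \<odot> x3"] by simp
    then show ?thesis by simp
  qed
  have "insert x (insert x2 (L 2)) \<subseteq> span (insert x (insert x2 (insert x3 (L 3))))"
    using L2 span_mono[of "insert x3 (L 3)" "insert x (insert x2 (insert x3 (L 3)))"]
    by (auto intro: span_base)
  then have "span (insert x (insert x2 (L 2))) \<subseteq> span (insert x (insert x2 (insert x3 (L 3))))"
    by (intro span_minimal) auto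
  then have U3: "span (insert x (insert x2 (insert x3 (L 3)))) = UNIV"
    using U2 by auto
  have L3: "L 3 \<subseteq> span {x4}"
  proof -
    have "a \<odot> b \<in> span {x4} \<and> b \<odot> a \<in> span {x4}" if "b \<in> L 2" for a b
    proof -
      have a: "a \<in> span (insert x (insert x2 (insert x3 (L 3))))" and b: "b \<in> span (insert x3 (L 3))"
        using U3 L2 that by auto
      have *: "s \<odot> t \<in> span {x4}" "t \<odot> s \<in> span {x4}"
        if "s \<in> insert x (insert x2 (insert x3 (L 3)))" "t \<in> insert x3 (L 3)" for s t
        using that x4' x23 x32 x33 ann
        by (auto simp: span_zero simp flip: x4_def intro: span_base)
      show ?thesis using span_mult[OF a b _ *(1)] span_mult[OF b a _ *(2)] by simp
    qed
    then show ?thesis unfolding L_def numeral_3_eq_3 numeral_2_eq_2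
      by (intro lower_series_Suc_minimal) auto
  qed
  have "insert x (insert x2 (insert x3 (L 3))) \<subseteq> span {x, x2, x3, x4}"
    using L3 span_mono[of "{x4}" "{x, x2, x3, x4}"] by (auto intro: span_base)
  then have "span (insert x (insert x2 (insert x3 (L 3)))) \<subseteq> span {x, x2, x3, x4}"
    by (intro span_minimal) auto
  then have U4: "span {x, x2, x3, x4} = UNIV"
    using U3 by auto
  show ?thesis
    by (rule isomorphic_if_basis[OF dim_4 U4 refl])
      (use x3' x4' x4'' x23 x32 x33 ann in_L in
        \<open>simp add: forall_4 sum_4 J_table_def axis_def fun_upd_def flip: x2_def x3_def x4_def\<close>)
qed

end

section \<open>Structure constants of algebras with lower series of dimensions 4, 2, 1, and their
  change of basis\<close>

section \<open>Adapted bases\<close>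

context complex_algebra
begin

(* v1, v2 span a complement of A^2, z spans A^2 modulo A^3 and w spans A^3; the parameters are the
   matrices of b and g and the coordinates of l and m. *)
definition adapted_basis where
  "adapted_basis v1 v2 z w b11 b12 b21 b22 g11 g12 g21 g22 l1 l2 m1 m2 \<longleftrightarrow>
    span {v1, v2, z, w} = UNIV \<and>
    v1 \<odot> v1 = smul b11 z + smul g11 w \<and> v1 \<odot> v2 = smul b12 z + smul g12 w \<and>
    v2 \<odot> v1 = smul b21 z + smul g21 w \<and> v2 \<odot> v2 = smul b22 z + smul g22 w \<and>
    v1 \<odot> z = smul l1 w \<and> v2 \<odot> z = smul l2 w \<and> z \<odot> v1 = smul m1 w \<and> z \<odot> v2 = smul m2 w \<and>
    z \<odot> z = 0 \<and> (\<forall>x. x \<odot> w = 0 \<and> w \<odot> x = 0)"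

text \<open>Hiding the four vectors lets the normalization act on the twelve parameters alone, one
  change of basis after another.\<close>

definition has_adapted_basis where
  "has_adapted_basis b11 b12 b21 b22 g11 g12 g21 g22 l1 l2 m1 m2 \<longleftrightarrow>
    (\<exists>v1 v2 z w. adapted_basis v1 v2 z w b11 b12 b21 b22 g11 g12 g21 g22 l1 l2 m1 m2)"

lemma adapted_basis_mult:
  assumes "adapted_basis v1 v2 z w b11 b12 b21 b22 g11 g12 g21 g22 l1 l2 m1 m2"
  shows "(smul x1 v1 + smul x2 v2 + smul x3 z + smul x4 w) \<odot>
      (smul y1 v1 + smul y2 v2 + smul y3 z + smul y4 w) =
    smul (b11 * x1 * y1 + b12 * x1 * y2 + b21 * x2 * y1 + b22 * x2 * y2) z +
    smul (g11 * x1 * y1 + g12 * x1 * y2 + g21 * x2 * y1 + g22 * x2 * y2 +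
      (l1 * x1 + l2 * x2) * y3 + (m1 * y1 + m2 * y2) * x3) w"
  using assms unfolding adapted_basis_def
  by (simp add: mult_add_left mult_add_right mult_scale_left mult_scale_right
      scale_left_distrib scale_right_distrib algebra_simps)

text \<open>The new basis is v1' = p1 v1 + p2 v2 + a1 z, v2' = q1 v1 + q2 v2 + a2 z, z' = c z + d w,
  w' = e w. Thus a1 and a2 move the lifts of the generators, and d subtracts a multiple of the new b
  from g. Without division in the equations, the new parameters can be prescribed instead of
  computed.\<close>

lemma has_adapted_basis_change:
  assumes "has_adapted_basis b11 b12 b21 b22 g11 g12 g21 g22 l1 l2 m1 m2"
    and nz: "p1 * q2 - p2 * q1 \<noteq> 0" "c \<noteq> 0" "e \<noteq> 0"
    and b: "b11' * c = b11 * p1 * p1 + b12 * p1 * p2 + b21 * p2 * p1 + b22 * p2 * p2"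
      "b12' * c = b11 * p1 * q1 + b12 * p1 * q2 + b21 * p2 * q1 + b22 * p2 * q2"
      "b21' * c = b11 * q1 * p1 + b12 * q1 * p2 + b21 * q2 * p1 + b22 * q2 * p2"
      "b22' * c = b11 * q1 * q1 + b12 * q1 * q2 + b21 * q2 * q1 + b22 * q2 * q2"
    and g: "b11' * d + g11' * e = g11 * p1 * p1 + g12 * p1 * p2 + g21 * p2 * p1 + g22 * p2 * p2 +
        (l1 * p1 + l2 * p2) * a1 + (m1 * p1 + m2 * p2) * a1"
      "b12' * d + g12' * e = g11 * p1 * q1 + g12 * p1 * q2 + g21 * p2 * q1 + g22 * p2 * q2 +
        (l1 * p1 + l2 * p2) * a2 + (m1 * q1 + m2 * q2) * a1"
      "b21' * d + g21' * e = g11 * q1 * p1 + g12 * q1 * p2 + g21 * q2 * p1 + g22 * q2 * p2 +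
        (l1 * q1 + l2 * q2) * a1 + (m1 * p1 + m2 * p2) * a2"
      "b22' * d + g22' * e = g11 * q1 * q1 + g12 * q1 * q2 + g21 * q2 * q1 + g22 * q2 * q2 +
        (l1 * q1 + l2 * q2) * a2 + (m1 * q1 + m2 * q2) * a2"
    and l: "l1' * e = (l1 * p1 + l2 * p2) * c" "l2' * e = (l1 * q1 + l2 * q2) * c"
      "m1' * e = (m1 * p1 + m2 * p2) * c" "m2' * e = (m1 * q1 + m2 * q2) * c"
  shows "has_adapted_basis b11' b12' b21' b22' g11' g12' g21' g22' l1' l2' m1' m2'"
proof -
  obtain v1 v2 z w
    where A: "adapted_basis v1 v2 z w b11 b12 b21 b22 g11 g12 g21 g22 l1 l2 m1 m2"
    using assms(1) has_adapted_basis_def by blast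
  define v1' where "v1' = smul p1 v1 + smul p2 v2 + smul a1 z"
  define v2' where "v2' = smul q1 v1 + smul q2 v2 + smul a2 z"
  define z' where "z' = smul c z + smul d w"
  define w' where "w' = smul e w"
  have eq: "smul \<beta> z + smul \<gamma> w = smul \<beta>' z' + smul \<gamma>' w'"
    if "\<beta>' * c = \<beta>" "\<beta>' * d + \<gamma>' * e = \<gamma>" for \<beta> \<gamma> \<beta>' \<gamma>'
    unfolding z'_def w'_def that[symmetric]
    by (simp add: scale_left_distrib scale_right_distrib add.assoc)
  note mult = adapted_basis_mult[OF A]
  have "v1' \<odot> v1' = smul b11' z' + smul g11' w'" "v1' \<odot> v2' = smul b12' z' + smul g12' w'"
    "v2' \<odot> v1' = smul b21' z' + smul g21' w'" "v2' \<odot> v2' = smul b22' z' + smul g22' w'"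
    using mult[of p1 p2 a1 0 p1 p2 a1 0] mult[of p1 p2 a1 0 q1 q2 a2 0]
      mult[of q1 q2 a2 0 p1 p2 a1 0] mult[of q1 q2 a2 0 q1 q2 a2 0]
      eq[OF b(1) g(1)] eq[OF b(2) g(2)] eq[OF b(3) g(3)] eq[OF b(4) g(4)]
    by (simp_all add: v1'_def v2'_def)
  moreover have "v1' \<odot> z' = smul l1' w'" "v2' \<odot> z' = smul l2' w'"
    "z' \<odot> v1' = smul m1' w'" "z' \<odot> v2' = smul m2' w'"
    using mult[of p1 p2 a1 0 0 0 c d] mult[of q1 q2 a2 0 0 0 c d]
      mult[of 0 0 c d p1 p2 a1 0] mult[of 0 0 c d q1 q2 a2 0]
    by (simp_all add: v1'_def v2'_def z'_def w'_def flip: l)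
  moreover have "z' \<odot> z' = 0"
    using mult[of 0 0 c d 0 0 c d] by (simp add: z'_def)
  moreover have "x \<odot> w' = 0 \<and> w' \<odot> x = 0" for x
    using A by (simp add: adapted_basis_def w'_def mult_scale_left mult_scale_right)
  moreover have "span {v1', v2', z', w'} = UNIV"
  proof -
    \<comment> \<open>The old vectors are recovered in the order w, z, v1, v2, the last two by
      Cramer's rule.\<close>
    let ?S = "span {v1', v2', z', w'}"
    have in_S: "v1' \<in> ?S" "v2' \<in> ?S" "z' \<in> ?S" "w' \<in> ?S" by (simp_all add: span_base)
    have "smul (1 / e) w' \<in> ?S" using in_S by (intro span_scale)
    then have w: "w \<in> ?S" using nz by (simp add: w'_def)
    have "smul (1 / c) (z' - smul d w) \<in> ?S" using in_S w by (intro span_scale span_diff)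
    then have z: "z \<in> ?S" using nz by (simp add: z'_def)
    define D where "D = p1 * q2 - p2 * q1"
    have "smul (1 / D) (smul q2 (v1' - smul a1 z) - smul p2 (v2' - smul a2 z)) \<in> ?S"
      using in_S z by (intro span_scale span_diff)
    also have "smul q2 (v1' - smul a1 z) - smul p2 (v2' - smul a2 z) = smul D v1"
      by (simp add: v1'_def v2'_def D_def algebra_simps)
    finally have v1: "v1 \<in> ?S" using nz by (simp add: D_def)
    have "smul (1 / D) (smul p1 (v2' - smul a2 z) - smul q1 (v1' - smul a1 z)) \<in> ?S"
      using in_S z by (intro span_scale span_diff)
    also have "smul p1 (v2' - smul a2 z) - smul q1 (v1' - smul a1 z) = smul D v2"
      by (simp add: v1'_def v2'_def D_def algebra_simps)
    finally have v2: "v2 \<in> ?S" using nz by (simp add: D_def)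
    have "span {v1, v2, z, w} \<subseteq> ?S"
      using v1 v2 z w by (intro span_minimal) auto
    then show ?thesis using A by (auto simp: adapted_basis_def)
  qed
  ultimately show ?thesis
    unfolding has_adapted_basis_def adapted_basis_def by blast
qed

lemma isomorphic_if_adapted_basis:
  assumes dim: "dim UNIV = 4"
    and "has_adapted_basis b11 b12 b21 b22 g11 g12 g21 g22 l1 l2 m1 m2"
    and "(n, b11, b12, b21, b22, g11, g12, g21, g22, l1, l2, m1, m2) \<in>
     {( 1, 1, 0,  0, 0, 0, 0, 0, 0, 1, 0,  1, 0),
      ( 2, 0, 0,  0, 1, 0, 1, 0, 0, 1, 0,  1, 0),
      ( 3, 1, 0,  0, 0, 0, 0, 1, 1, 1, 0,  1, 0),
      ( 4, 1, 0,  0, 0, 0, 0, 1, 0, 1, 0,  1, 0),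
      ( 5, 0, 0,  0, 1, 0, 0, 0, 0, 1, 0,  1, 0),
      ( 6, 1, 0,  0, 0, 0, 0, 0, 1, 1, 0,  1, 0),
      ( 7, 0, 1,  1, 0, 0, 0, 1, 0, 1, 1,  1, 1),
      ( 8, 0, 1,  1, 0, 0, 0, 1, 1, 1, 0,  1, 0),
      ( 9, 0, 1,  1, 0, 0, 0, 1, 0, 1, 0,  1, 0),
      (10, 0, 1,  1, 0, 0, 0, 0, 0, 1, 1,  1, 1),
      (11, 0, 1,  1, 0, 0, 0, 0, 0, 1, 0,  1, 0),
      (12, 0, 1,  1, 0, 0, 0, 0, 1, 1, 0,  1, 0),
      (13, 0, 1, -1, 0, 0, 0, 0, 0, 1, 0, -1, 0),
      (14, 0, 1, -1, 0, 1, 0, 0, 0, 1, 0, -1, 0),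
      (15, 0, 1, -1, 0, 0, 0, 1, 0, 1, 0, -1, 0),
      (16, 0, 1, -1, 0, 0, 0, 0, 1, 1, 0, -1, 0),
      (17, 0, 1, -1, 0, 1, 0, 0, 1, 1, 0, -1, 0)}"
  shows "algebra_isomorphic smul (\<odot>) (*s) (J_mult n)"
proof -
  obtain v1 v2 z w
    where A: "adapted_basis v1 v2 z w b11 b12 b21 b22 g11 g12 g21 g22 l1 l2 m1 m2"
    using assms(2) has_adapted_basis_def by blast
  then have span: "span {v1, v2, z, w} = UNIV" by (simp add: adapted_basis_def)
  \<comment> \<open>The listed bases permute the adapted one: \<open>span1\<close> serves J_01,
    \<open>span2\<close> J_02 and J_05, \<open>span3\<close> J_03, J_04 and J_06, and
    \<open>span\<close> the others.\<close>
  have span1: "span {v1, z, w, v2} = UNIV" and span2: "span {v2, z, v1, w} = UNIV"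
    and span3: "span {v1, z, v2, w} = UNIV"
    using span by (simp_all add: insert_commute)
  show ?thesis
    using assms(3) A unfolding adapted_basis_def
    apply (elim insertE emptyE; elim Pair_inject; hypsubst_thin)
    subgoal by (rule isomorphic_if_basis[OF dim span1 refl])
      (simp add: forall_4 sum_4 J_table_def axis_def fun_upd_def)
    subgoal by (rule isomorphic_if_basis[OF dim span2 refl])
      (simp add: forall_4 sum_4 J_table_def axis_def fun_upd_def)
    subgoal by (rule isomorphic_if_basis[OF dim span3 refl])
      (simp add: forall_4 sum_4 J_table_def axis_def fun_upd_def)
    subgoal by (rule isomorphic_if_basis[OF dim span3 refl])
      (simp add: forall_4 sum_4 J_table_def axis_def fun_upd_def)
    subgoal by (rule isomorphic_if_basis[OF dim span2 refl])
      (simp add: forall_4 sum_4 J_table_def axis_def fun_upd_def)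
    subgoal by (rule isomorphic_if_basis[OF dim span3 refl])
      (simp add: forall_4 sum_4 J_table_def axis_def fun_upd_def)
    subgoal by (rule isomorphic_if_basis[OF dim span refl])
      (simp add: forall_4 sum_4 J_table_def axis_def fun_upd_def)
    subgoal by (rule isomorphic_if_basis[OF dim span refl])
      (simp add: forall_4 sum_4 J_table_def axis_def fun_upd_def)
    subgoal by (rule isomorphic_if_basis[OF dim span refl])
      (simp add: forall_4 sum_4 J_table_def axis_def fun_upd_def)
    subgoal by (rule isomorphic_if_basis[OF dim span refl])
      (simp add: forall_4 sum_4 J_table_def axis_def fun_upd_def)
    subgoal by (rule isomorphic_if_basis[OF dim span refl])
      (simp add: forall_4 sum_4 J_table_def axis_def fun_upd_def)
    subgoal by (rule isomorphic_if_basis[OF dim span refl])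
      (simp add: forall_4 sum_4 J_table_def axis_def fun_upd_def)
    subgoal by (rule isomorphic_if_basis[OF dim span refl])
      (simp add: forall_4 sum_4 J_table_def axis_def fun_upd_def)
    subgoal by (rule isomorphic_if_basis[OF dim span refl])
      (simp add: forall_4 sum_4 J_table_def axis_def fun_upd_def)
    subgoal by (rule isomorphic_if_basis[OF dim span refl])
      (simp add: forall_4 sum_4 J_table_def axis_def fun_upd_def)
    subgoal by (rule isomorphic_if_basis[OF dim span refl])
      (simp add: forall_4 sum_4 J_table_def axis_def fun_upd_def)
    subgoal by (rule isomorphic_if_basis[OF dim span refl])
      (simp add: forall_4 sum_4 J_table_def axis_def fun_upd_def)
    done
qed

end

section \<open>Normal forms of b and g relative to the line l = 0\<close>

section \<open>Classification\<close>

context complex_algebra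
begin

text \<open>Here l is the first coordinate and v2 spans the line l = 0. The cases are: b nonzero on
  this line; b zero on it but pairing it with v1; b a multiple of l times l. In each case a first
  change of basis clears g up to the difference of g12 and g21 and, when b vanishes on the line,
  g22. What is left is then normalized further.\<close>

lemma isomorphic_if_symmetric:
  assumes dim: "dim UNIV = 4"
    and A: "has_adapted_basis b11 b12 b12 b22 g11 g12 g21 g22 1 0 1 0"
    and nz: "b11 \<noteq> 0 \<or> b12 \<noteq> 0 \<or> b22 \<noteq> 0"
  shows "\<exists>n\<in>{1..18}. algebra_isomorphic smul (\<odot>) (*s) (J_mult n)"
proof -
  note J = isomorphic_if_adapted_basis[OF dim]
  consider (anisotropic) "b22 \<noteq> 0" | (hyperbolic) "b22 = 0" "b12 \<noteq> 0"
    | (parallel) "b22 = 0" "b12 = 0" "b11 \<noteq> 0"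
    using nz by blast
  then show ?thesis
  proof cases
    case anisotropic
    \<comment> \<open>v1 + r v2 is b-orthogonal to v2, and \<alpha> is its b-square. Below,
      \<open>d\<close> removes g22, and \<open>a2\<close> and \<open>a1\<close> remove g21 and
      g11.\<close>
    define r where "r = - b12 / b22"
    define \<alpha> where "\<alpha> = b11 - b12\<^sup>2 / b22"
    define D where "D = g12 - g21"
    have "has_adapted_basis \<alpha> 0 0 b22 0 D 0 0 1 0 1 0"
      by (rule has_adapted_basis_change[OF A, where ?p1.0 = 1 and ?p2.0 = r and ?q1.0 = 0 and ?q2.0 = 1
            and c = 1 and d = "g22 / b22" and e = 1 and ?a2.0 = "- (g21 + g22 * r)"
            and ?a1.0 = "(\<alpha> * (g22 / b22) - (g11 + g12 * r + g21 * r + g22 * r\<^sup>2)) / 2"])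
        (use anisotropic in \<open>simp_all add: r_def \<alpha>_def D_def field_simps power2_eq_square\<close>)
    note A = this
    show ?thesis
    proof (cases "\<alpha> = 0")
      case True
      \<comment> \<open>For nonzero D this solves t^2 b22 = D t, so that g12 becomes 1.\<close>
      define t where "t = (if D = 0 then 1 else D / b22)"
      have "has_adapted_basis 0 0 0 1 0 (if D = 0 then 0 else 1) 0 0 1 0 1 0"
        by (rule has_adapted_basis_change[OF A, where ?p1.0 = 1 and ?p2.0 = 0 and ?q1.0 = 0 and ?q2.0 = t
              and c = "t\<^sup>2 * b22" and d = 0 and e = "t\<^sup>2 * b22" and ?a1.0 = 0 and ?a2.0 = 0])
          (use anisotropic True in \<open>auto simp: t_def field_simps power2_eq_square\<close>)
      then show ?thesis
        using J[of _ _ _ _ _ _ _ _ _ _ _ _ 2] J[of _ _ _ _ _ _ _ _ _ _ _ _ 5]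
        by (cases "D = 0") force+
    next
      case False
      (* the isotropic lines of b are spanned by v1 + \<kappa> v2 and v1 - \<kappa> v2 *)
      define \<kappa> where "\<kappa> = csqrt (- \<alpha> / b22)"
      have \<kappa>: "\<kappa> \<noteq> 0" "\<kappa> * \<kappa> * b22 = - \<alpha>"
        using False anisotropic by (auto simp: \<kappa>_def simp flip: power2_eq_square)
      \<comment> \<open>On the isotropic vectors scaled by P, b takes the value c = 2 P^2 \<alpha>,
        and l = (1, 1) forces e = P c. The entry g21 becomes 2 \<kappa> D P^2 / e, which is 1 for
        this P.\<close>
      define P where "P = (if D = 0 then 1 else \<kappa> * D / \<alpha>)"
      have P: "P \<noteq> 0" "D = 0 \<or> P * \<alpha> = \<kappa> * D"
        using False \<kappa> by (auto simp: P_def)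
      have "has_adapted_basis 0 1 1 0 0 0 (if D = 0 then 0 else 1) 0 1 1 1 1"
      proof (rule has_adapted_basis_change[OF A, where ?p1.0 = P and ?p2.0 = "P * \<kappa>" and ?q1.0 = P
            and ?q2.0 = "- P * \<kappa>" and c = "2 * P\<^sup>2 * \<alpha>" and d = "- P\<^sup>2 * \<kappa> * D" and e = "2 * P ^ 3 * \<alpha>"
            and ?a1.0 = "- P * \<kappa> * D / 2" and ?a2.0 = "P * \<kappa> * D / 2"])
      qed (use False P \<kappa> in \<open>auto simp: field_simps power2_eq_square power3_eq_cube\<close>)
      then show ?thesis
        using J[of _ _ _ _ _ _ _ _ _ _ _ _ 7] J[of _ _ _ _ _ _ _ _ _ _ _ _ 10]
        by (cases "D = 0") force+
    qed
  next
    case hyperbolic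
    \<comment> \<open>As b22 = 0, this makes v1 + r v2 isotropic for b.\<close>
    define r where "r = - b11 / (2 * b12)"
    define E where "E = (g21 - g12) / b12"
    define C where "C = g22 / b12"
    have "has_adapted_basis 0 1 1 0 0 0 E C 1 0 1 0"
      by (rule has_adapted_basis_change[OF A, where ?p1.0 = 1 and ?p2.0 = r and ?q1.0 = 0 and ?q2.0 = 1
            and c = b12 and d = 0 and e = b12 and ?a2.0 = "- (g12 + g22 * r)"
            and ?a1.0 = "- (g11 + g12 * r + g21 * r + g22 * r\<^sup>2) / 2"])
        (use hyperbolic in \<open>simp_all add: r_def E_def C_def field_simps power2_eq_square\<close>)
    note A = this
    \<comment> \<open>Scaling v1 by P and v2 by t turns E and C into E / P and C t / P^2.\<close>
    define P where "P = (if E = 0 then 1 else E)"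
    define t where "t = (if C = 0 then 1 else P\<^sup>2 / C)"
    have nz: "P \<noteq> 0" "t \<noteq> 0" by (auto simp: P_def t_def)
    have "has_adapted_basis 0 1 1 0 0 0 (if E = 0 then 0 else 1) (if C = 0 then 0 else 1) 1 0 1 0"
      by (rule has_adapted_basis_change[OF A, where ?p1.0 = P and ?p2.0 = 0 and ?q1.0 = 0 and ?q2.0 = t
            and c = "P * t" and d = 0 and e = "P\<^sup>2 * t" and ?a1.0 = 0 and ?a2.0 = 0])
        (use nz in \<open>auto simp: P_def t_def field_simps power2_eq_square\<close>)
    then show ?thesis
      using J[of _ _ _ _ _ _ _ _ _ _ _ _ 8] J[of _ _ _ _ _ _ _ _ _ _ _ _ 9]
        J[of _ _ _ _ _ _ _ _ _ _ _ _ 11] J[of _ _ _ _ _ _ _ _ _ _ _ _ 12]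
      by (cases "E = 0"; cases "C = 0") force+
  next
    case parallel
    define E where "E = (g21 - g12) / b11"
    define C where "C = g22 / b11"
    have "has_adapted_basis 1 0 0 0 0 0 E C 1 0 1 0"
      by (rule has_adapted_basis_change[OF A, where ?p1.0 = 1 and ?p2.0 = 0 and ?q1.0 = 0 and ?q2.0 = 1
            and c = b11 and d = 0 and e = b11 and ?a2.0 = "- g12" and ?a1.0 = "- g11 / 2"])
        (use parallel in \<open>simp_all add: E_def C_def field_simps power2_eq_square\<close>)
    note A = this
    \<comment> \<open>Now c = P^2 and e = P^3, so E and C become E t / P^2 and C t^2 / P^3; P and t
      make the nonzero ones equal to 1.\<close>
    define P where "P = (if E = 0 then if C = 0 then 1 else C else if C = 0 then 1 else E\<^sup>2 / C)"
    define t where "t = (if E = 0 then P else P\<^sup>2 / E)"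
    have nz: "P \<noteq> 0" "t \<noteq> 0" by (auto simp: P_def t_def)
    have "has_adapted_basis 1 0 0 0 0 0 (if E = 0 then 0 else 1) (if C = 0 then 0 else 1) 1 0 1 0"
      by (rule has_adapted_basis_change[OF A, where ?p1.0 = P and ?p2.0 = 0 and ?q1.0 = 0 and ?q2.0 = t
            and c = "P\<^sup>2" and d = 0 and e = "P ^ 3" and ?a1.0 = 0 and ?a2.0 = 0])
        (use nz in \<open>auto simp: P_def t_def field_simps power2_eq_square power3_eq_cube\<close>)
    then show ?thesis
      using J[of _ _ _ _ _ _ _ _ _ _ _ _ 1] J[of _ _ _ _ _ _ _ _ _ _ _ _ 3]
        J[of _ _ _ _ _ _ _ _ _ _ _ _ 4] J[of _ _ _ _ _ _ _ _ _ _ _ _ 6]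
      by (cases "E = 0"; cases "C = 0") force+
  qed
qed

text \<open>Since m = -l, \<open>a2\<close> shifts g12 and g21 by opposite amounts. Only the
  quadratic form a x1^2 + h x1 x2 + k x2^2 remains, and it is normalized according to its behaviour
  on and near the line spanned by v2.\<close>

lemma isomorphic_if_alternating:
  assumes dim: "dim UNIV = 4"
    and A: "has_adapted_basis 0 b (- b) 0 g11 g12 g21 g22 1 0 (-1) 0"
    and nz: "b \<noteq> 0"
  shows "\<exists>n\<in>{1..18}. algebra_isomorphic smul (\<odot>) (*s) (J_mult n)"
proof -
  note J = isomorphic_if_adapted_basis[OF dim]
  define a where "a = g11 / b"
  define h where "h = (g12 + g21) / b"
  define k where "k = g22 / b"
  have "has_adapted_basis 0 1 (-1) 0 a 0 h k 1 0 (-1) 0"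
    by (rule has_adapted_basis_change[OF A, where ?p1.0 = 1 and ?p2.0 = 0 and ?q1.0 = 0 and ?q2.0 = 1
          and c = b and d = 0 and e = b and ?a2.0 = "- g12" and ?a1.0 = 0])
      (use nz in \<open>simp_all add: a_def h_def k_def field_simps\<close>)
  note A = this
  consider (zero) "k = 0" "h = 0" "a = 0" | (square) "k = 0" "h = 0" "a \<noteq> 0"
    | (mixed) "k = 0" "h \<noteq> 0" | (nonzero) "k \<noteq> 0" by blast
  then show ?thesis
  proof cases
    case zero
    then show ?thesis using J[OF A, of 13] by force
  next
    case square
    have "has_adapted_basis 0 1 (-1) 0 1 0 0 0 1 0 (-1) 0"
      by (rule has_adapted_basis_change[OF A, where ?p1.0 = 1 and ?p2.0 = 0 and ?q1.0 = 0 and ?q2.0 = a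
            and c = a and d = 0 and e = a and ?a2.0 = 0 and ?a1.0 = 0])
        (use square in simp_all)
    then show ?thesis using J[of _ _ _ _ _ _ _ _ _ _ _ _ 14] by force
  next
    case mixed
    \<comment> \<open>h v1 - a v2 is a zero of the form a x1^2 + h x1 x2.\<close>
    have "has_adapted_basis 0 1 (-1) 0 0 0 1 0 1 0 (-1) 0"
      by (rule has_adapted_basis_change[OF A, where ?p1.0 = h and ?p2.0 = "- a" and ?q1.0 = 0 and ?q2.0 = 1
            and c = h and d = 0 and e = "h\<^sup>2" and ?a2.0 = 0 and ?a1.0 = 0])
        (use mixed in \<open>simp_all add: power2_eq_square\<close>)
    then show ?thesis using J[of _ _ _ _ _ _ _ _ _ _ _ _ 15] by force
  next
    case nonzero
    \<comment> \<open>Completing the square: \<Delta> is the value of the form at v1 - (h / (2 k))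
      v2. Scaling this vector by P and v2 by t gives the diagonal entries \<Delta> / t and k t /
      P^2, which explains P^2 = \<Delta> k and t = P^2 / k.\<close>
    define \<Delta> where "\<Delta> = a - h\<^sup>2 / (4 * k)"
    define P where "P = (if \<Delta> = 0 then 1 else csqrt (\<Delta> * k))"
    have P: "P \<noteq> 0" "\<Delta> = 0 \<or> P\<^sup>2 = \<Delta> * k"
      using nonzero by (auto simp: P_def)
    define t where "t = P\<^sup>2 / k"
    have "has_adapted_basis 0 1 (-1) 0 (if \<Delta> = 0 then 0 else 1) 0 0 1 1 0 (-1) 0"
    proof (rule has_adapted_basis_change[OF A, where ?p1.0 = P and ?p2.0 = "- h * P / (2 * k)"
            and ?q1.0 = 0 and ?q2.0 = t and c = "P * t" and d = 0 and e = "P\<^sup>2 * t"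
            and ?a2.0 = "h * t / 2" and ?a1.0 = 0])
      have "P\<^sup>2 * \<Delta> = (if \<Delta> = 0 then 0 else P\<^sup>2 * t)"
      proof -
        have "\<Delta> \<noteq> 0 \<Longrightarrow> t = \<Delta>" using P nonzero by (auto simp: t_def)
        then show ?thesis by simp
      qed
      moreover have "a * P * P + h * (- h * P / (2 * k)) * P + k * (- h * P / (2 * k)) * (- h * P / (2 * k)) = P\<^sup>2 * \<Delta>"
        using nonzero by (simp add: \<Delta>_def field_simps power2_eq_square)
      ultimately show "0 * 0 + (if \<Delta> = 0 then 0 else 1) * (P\<^sup>2 * t) =
          a * P * P + 0 * P * (- h * P / (2 * k)) + h * (- h * P / (2 * k)) * P +
          k * (- h * P / (2 * k)) * (- h * P / (2 * k)) +
          (1 * P + 0 * (- h * P / (2 * k))) * 0 + (- 1 * P + 0 * (- h * P / (2 * k))) * 0"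
        by simp
    qed (use nonzero P in \<open>simp_all add: t_def field_simps power2_eq_square\<close>)
    then show ?thesis
      using J[of _ _ _ _ _ _ _ _ _ _ _ _ 16] J[of _ _ _ _ _ _ _ _ _ _ _ _ 17]
      by (cases "\<Delta> = 0") force+
  qed
qed

text \<open>Coordinates on the plane in which l is the first one. With s = 1 and s = -1 this serves
  both cases of \<open>flexible_dichotomy\<close>.\<close>

lemma has_adapted_basis_rotate:
  assumes "has_adapted_basis b11 b12 b21 b22 g11 g12 g21 g22 l1 l2 (s * l1) (s * l2)"
    and "l1 \<noteq> 0 \<or> l2 \<noteq> 0"
  obtains p1 p2 q1 q2 g11' g12' g21' g22' where "p1 * q2 - p2 * q1 \<noteq> 0"
    "has_adapted_basis (b11 * p1 * p1 + b12 * p1 * p2 + b21 * p2 * p1 + b22 * p2 * p2)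
      (b11 * p1 * q1 + b12 * p1 * q2 + b21 * p2 * q1 + b22 * p2 * q2)
      (b11 * q1 * p1 + b12 * q1 * p2 + b21 * q2 * p1 + b22 * q2 * p2)
      (b11 * q1 * q1 + b12 * q1 * q2 + b21 * q2 * q1 + b22 * q2 * q2)
      g11' g12' g21' g22' 1 0 s 0"
proof -
  obtain p1 p2 q1 q2 where pq: "p1 * q2 - p2 * q1 \<noteq> 0" "l1 * p1 + l2 * p2 = 1" "l1 * q1 + l2 * q2 = 0"
  proof (cases "l1 = 0")
    case True
    then show ?thesis using assms(2) that[where ?p1.0 = 0 and ?p2.0 = "1 / l2" and ?q1.0 = 1 and ?q2.0 = 0] by simp
  next
    case False
    then show ?thesis using that[where ?p1.0 = "1 / l1" and ?p2.0 = 0 and ?q1.0 = "- l2" and ?q2.0 = l1] by simp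
  qed
  have s: "s * l1 * p1 + s * l2 * p2 = s * (l1 * p1 + l2 * p2)"
    "s * l1 * q1 + s * l2 * q2 = s * (l1 * q1 + l2 * q2)"
    by (simp_all add: algebra_simps)
  show ?thesis
    by (rule that[OF pq(1)], rule has_adapted_basis_change[OF assms(1) pq(1), where c = 1 and d = 0
          and e = 1 and ?a1.0 = 0 and ?a2.0 = 0
          and g11' = "g11 * p1 * p1 + g12 * p1 * p2 + g21 * p2 * p1 + g22 * p2 * p2"
          and g12' = "g11 * p1 * q1 + g12 * p1 * q2 + g21 * p2 * q1 + g22 * p2 * q2"
          and g21' = "g11 * q1 * p1 + g12 * q1 * p2 + g21 * q2 * p1 + g22 * q2 * p2"
          and g22' = "g11 * q1 * q1 + g12 * q1 * q2 + g21 * q2 * q1 + g22 * q2 * q2"])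
      (simp_all add: pq s)
qed

end

section \<open>Existence of adapted bases, the flexible dichotomy and the conclusion\<close>

context nilpotent_ncj4
begin

lemma obtain_not_in_span:
  assumes "dim S < 4"
  obtains x where "x \<notin> span S"
proof -
  have "span S \<noteq> UNIV"
  proof
    assume *: "span S = UNIV"
    have "dim S = dim (span S)" by (rule dim_span[symmetric])
    also have "\<dots> = 4" unfolding * by (rule dim_4)
    finally show False using assms by simp
  qed
  then show ?thesis using that by blast
qed

text \<open>The lower series has dimensions 4, 2, 1, 0; w spans A^3, z extends it to A^2, and v1, v2
  to A. If b were zero, A^2 would lie in A^3; if l and m were zero, A^3 would vanish.\<close>

lemma obtain_adapted_basis:
  assumes dim2: "dim (lower_series 1) = 2"
  obtains v1 v2 z w b11 b12 b21 b22 g11 g12 g21 g22 l1 l2 m1 m2 where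
    "adapted_basis v1 v2 z w b11 b12 b21 b22 g11 g12 g21 g22 l1 l2 m1 m2"
    "w \<noteq> 0" "b11 \<noteq> 0 \<or> b12 \<noteq> 0 \<or> b21 \<noteq> 0 \<or> b22 \<noteq> 0" "l1 \<noteq> 0 \<or> l2 \<noteq> 0 \<or> m1 \<noteq> 0 \<or> m2 \<noteq> 0"
proof -
  define L where "L = lower_series"
  have L12: "L (Suc 0) = lower_series 1" "L (Suc (Suc 0)) = lower_series 2"
    by (simp_all add: L_def numeral_2_eq_2)
  have LS: "subspace (L k)" "span (L k) = L k" for k
    by (simp_all add: L_def)
  have mL: "y \<in> L k \<Longrightarrow> a \<odot> y \<in> L (Suc k)" "y \<in> L k \<Longrightarrow> y \<odot> a \<in> L (Suc k)" for y k a
    unfolding L_def by (rule mult_lower_series; assumption)+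
  have d1: "dim (L (Suc 0)) = 2" using dim2 L12 by simp
  have L2: "L (Suc (Suc 0)) \<noteq> {0}" using dim_lower_series(2) L12 by simp
  then have "dim (L (Suc (Suc 0))) \<noteq> 0"
    using subspace_0[OF LS(1), of "Suc (Suc 0)"] by auto
  moreover have "dim (L (Suc (Suc 0))) < 2"
    using dim_lower_series_less[of "Suc 0"] d1 unfolding L_def
    by (metis dim_eq_0 order_refl zero_neq_numeral)
  ultimately have d2: "dim (L (Suc (Suc 0))) = 1" by linarith
  then have L3: "L (Suc (Suc (Suc 0))) = {0}"
    unfolding L_def by (intro lower_series_eq_0) simp
  obtain w where w: "w \<in> L (Suc (Suc 0))" "w \<noteq> 0"
    using L2 subspace_0[OF LS(1), of "Suc (Suc 0)"] by blast
  have "span {w} = L (Suc (Suc 0))"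
    using subspace_dim_equal[of "span {w}" "L (Suc (Suc 0))"] w d2 LS span_minimal[of "{w}" "L (Suc (Suc 0))"]
    by simp
  then have Lw: "x \<in> L (Suc (Suc 0)) \<longleftrightarrow> (\<exists>c. x = smul c w)" for x
    by (auto simp: span_singleton)
  have ann: "x \<odot> w = 0" "w \<odot> x = 0" for x
    using mL[OF w(1), of x] L3 by auto
  have sub: "L (Suc (Suc 0)) \<subseteq> L (Suc 0)" unfolding L_def by (rule lower_series_Suc_subset)
  moreover have "L (Suc 0) \<noteq> L (Suc (Suc 0))" using d1 d2 by auto
  ultimately obtain z where z: "z \<in> L (Suc 0)" "z \<notin> L (Suc (Suc 0))" by blast
  have zw2: "dim {z, w} = 2"
    using z w by (simp add: dim_insert span_singleton Lw)
       (metis rangeE)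
  have spanzw: "span {z, w} = L (Suc 0)"
    using subspace_dim_equal[of "span {z, w}" "L (Suc 0)"] d1 zw2 LS z w sub
      span_minimal[of "{z, w}" "L (Suc 0)"] by auto
  have Lzw: "x \<in> L (Suc 0) \<longleftrightarrow> (\<exists>b g. x = smul b z + smul g w)" for x
  proof
    assume "x \<in> L (Suc 0)"
    then obtain b g where "x - smul b z - smul g w = 0"
      unfolding spanzw[symmetric] span_breakdown_eq span_empty by blast
    then have "x = smul b z + smul g w" by (simp add: algebra_simps)
    then show "\<exists>b g. x = smul b z + smul g w" by blast
  next
    assume "\<exists>b g. x = smul b z + smul g w"
    then show "x \<in> L (Suc 0)"
      unfolding spanzw[symmetric] by (auto intro!: span_add span_scale intro: span_base)
  qed
  obtain v2 where v2: "v2 \<notin> span {z, w}"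
    by (rule obtain_not_in_span[of "{z, w}"]) (use zw2 in simp)
  have d3: "dim {v2, z, w} = 3" using v2 zw2 by (simp add: dim_insert)
  obtain v1 where v1: "v1 \<notin> span {v2, z, w}"
    by (rule obtain_not_in_span[of "{v2, z, w}"]) (use d3 in simp)
  have span: "span {v1, v2, z, w} = UNIV"
    using span_insert_eq_UNIV[OF d3 v1] .
  have prod: "\<exists>b g. x \<odot> y = smul b z + smul g w" for x y
    using mL(1)[of y 0 x] Lzw by (simp add: L_def)
  have left: "\<exists>l. x \<odot> z = smul l w" and right: "\<exists>m. z \<odot> x = smul m w" for x
    using mL(1)[OF z(1)] mL(2)[OF z(1)] Lw by simp_all
  \<comment> \<open>Multiplication by z sends A into A^3, which annihilates everything, so (xy)z and
    z(xy) equal \<beta>(x,y) zz. If zz is nonzero, flexibility makes \<beta> symmetric, the Jordan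
    identity at y = x gives \<beta>(x,x)^2 = 0, and polarization gives \<beta> = 0. Then A^2 lies in
    A^3, a contradiction.\<close>
  have zz: "z \<odot> z = 0"
  proof (rule ccontr)
    assume nz: "z \<odot> z \<noteq> 0"
    define \<beta> where "\<beta> x y = (SOME b. \<exists>g. x \<odot> y = smul b z + smul g w)" for x y
    have \<beta>: "\<exists>g. x \<odot> y = smul (\<beta> x y) z + smul g w" for x y
      unfolding \<beta>_def by (rule someI_ex[OF prod])
    have ann_z: "(z \<odot> x) \<odot> y = 0" "y \<odot> (x \<odot> z) = 0" for x y
      using left[of x] right[of x] ann by (auto simp: mult_scale_left mult_scale_right)
    have xyz: "(x \<odot> y) \<odot> z = smul (\<beta> x y) (z \<odot> z)" "z \<odot> (x \<odot> y) = smul (\<beta> x y) (z \<odot> z)" for x y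
      using \<beta>[of x y] ann
      by (auto simp: mult_add_left mult_add_right mult_scale_left mult_scale_right)
    have sym: "smul (\<beta> x y) (z \<odot> z) = smul (\<beta> y x) (z \<odot> z)" for x y
      using flexible_linearized[of x y z] unfolding xyz ann_z by auto
    have diag: "smul (\<beta> x x) (z \<odot> z) = 0" for x
    proof -
      obtain g where g: "x \<odot> x = smul (\<beta> x x) z + smul g w" using \<beta> by blast
      have "(x \<odot> x) \<odot> (x \<odot> x) = ((x \<odot> x) \<odot> x) \<odot> x" by (rule jordan)
      then have "smul (\<beta> x x * \<beta> x x) (z \<odot> z) = 0"
        unfolding g using ann ann_z
        by (simp add: mult_add_left mult_add_right mult_scale_left mult_scale_right)
      then show ?thesis using nz by simp
    qed
    have "smul (\<beta> x y) (z \<odot> z) = 0" for x y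
    proof -
      have "z \<odot> ((x + y) \<odot> (x + y)) = z \<odot> (x \<odot> x) + z \<odot> (x \<odot> y) + z \<odot> (y \<odot> x) + z \<odot> (y \<odot> y)"
        by (simp add: mult_add_left mult_add_right algebra_simps)
      then have "smul (\<beta> x y) (z \<odot> z) + smul (\<beta> x y) (z \<odot> z) = 0"
        unfolding xyz diag using sym[of y x] by simp
      then have "smul (2 * \<beta> x y) (z \<odot> z) = 0"
        by (metis mult_2 scale_left_distrib)
      then show ?thesis by simp
    qed
    then have "\<beta> x y = 0" for x y using nz by simp
    then have "x \<odot> y \<in> L (Suc (Suc 0))" for x y
      using \<beta>[of x y] Lw by auto
    then have "L (Suc 0) \<subseteq> L (Suc (Suc 0))"
      unfolding L_def[THEN fun_cong, of "Suc 0"]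
      by (intro lower_series_Suc_minimal) (simp_all add: LS)
    then show False using z by blast
  qed
  obtain b11 g11 where p11: "v1 \<odot> v1 = smul b11 z + smul g11 w" using prod by blast
  obtain b12 g12 where p12: "v1 \<odot> v2 = smul b12 z + smul g12 w" using prod by blast
  obtain b21 g21 where p21: "v2 \<odot> v1 = smul b21 z + smul g21 w" using prod by blast
  obtain b22 g22 where p22: "v2 \<odot> v2 = smul b22 z + smul g22 w" using prod by blast
  obtain l1 where l1: "v1 \<odot> z = smul l1 w" using left by blast
  obtain l2 where l2: "v2 \<odot> z = smul l2 w" using left by blast
  obtain m1 where m1: "z \<odot> v1 = smul m1 w" using right by blast
  obtain m2 where m2: "z \<odot> v2 = smul m2 w" using right by blast
  show thesis
  proof (rule that)
    show "adapted_basis v1 v2 z w b11 b12 b21 b22 g11 g12 g21 g22 l1 l2 m1 m2"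
      unfolding adapted_basis_def
      using span p11 p12 p21 p22 l1 l2 m1 m2 zz ann by auto
    show "w \<noteq> 0" by (rule w)
    show "b11 \<noteq> 0 \<or> b12 \<noteq> 0 \<or> b21 \<noteq> 0 \<or> b22 \<noteq> 0"
    proof (rule ccontr)
      assume *: "\<not> ?thesis"
      have "x \<odot> y \<in> L (Suc (Suc 0))" for x y
      proof (rule span_mult)
        show "x \<in> span {v1, v2, z, w}" "y \<in> span {v1, v2, z, w}" using span by simp_all
        fix s t assume "s \<in> {v1, v2, z, w}" "t \<in> {v1, v2, z, w}"
        then show "s \<odot> t \<in> L (Suc (Suc 0))"
          using * p11 p12 p21 p22 mL[OF z(1)] ann w(1) LS(1)[THEN subspace_0] 
          by (auto simp: LS subspace_scale)
      qed (rule LS)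
      then have "L (Suc 0) \<subseteq> L (Suc (Suc 0))"
        unfolding L_def[THEN fun_cong, of "Suc 0"]
        by (intro lower_series_Suc_minimal) (simp_all add: LS)
      then show False using z by blast
    qed
    show "l1 \<noteq> 0 \<or> l2 \<noteq> 0 \<or> m1 \<noteq> 0 \<or> m2 \<noteq> 0"
    proof (rule ccontr)
      assume *: "\<not> ?thesis"
      have "x \<odot> y = 0 \<and> y \<odot> x = 0" if "y \<in> L (Suc 0)" for x y
      proof -
        have x: "x \<in> span {v1, v2, z, w}" and y: "y \<in> span {z, w}" using span spanzw that by simp_all
        have "s \<odot> t \<in> {0}" "t \<odot> s \<in> {0}" if "s \<in> {v1, v2, z, w}" "t \<in> {z, w}" for s t
          using that * l1 l2 m1 m2 zz ann by auto
        then have "x \<odot> y \<in> {0}" "y \<odot> x \<in> {0}"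
          using span_mult[OF x y, of "{0}"] span_mult[OF y x, of "{0}"] by (metis subspace_single_0)+
        then show ?thesis by simp
      qed
      then have "L (Suc (Suc 0)) \<subseteq> {0}"
        unfolding L_def by (intro lower_series_Suc_minimal) (auto simp: subspace_single_0)
      with L2 w show False by auto
    qed
  qed
qed

text \<open>The coefficients of b(y,x) l(x) = b(x,y) m(x) are compared. A nonzero diagonal entry of
  b forces m = l and then symmetry; otherwise the two off-diagonal entries have equal squares and
  their relative sign decides.\<close>

lemma flexible_dichotomy:
  assumes A: "adapted_basis v1 v2 z w b11 b12 b21 b22 g11 g12 g21 g22 l1 l2 m1 m2"
    and "w \<noteq> 0" and b: "b11 \<noteq> 0 \<or> b12 \<noteq> 0 \<or> b21 \<noteq> 0 \<or> b22 \<noteq> 0"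
    and l: "l1 \<noteq> 0 \<or> l2 \<noteq> 0 \<or> m1 \<noteq> 0 \<or> m2 \<noteq> 0"
  shows "m1 = l1 \<and> m2 = l2 \<and> b21 = b12 \<or>
    m1 = - l1 \<and> m2 = - l2 \<and> b11 = 0 \<and> b22 = 0 \<and> b21 = - b12"
proof -
  note mult = adapted_basis_mult[OF A]
  have flex: "(b11 * y1 * x1 + b12 * y1 * x2 + b21 * y2 * x1 + b22 * y2 * x2) * (l1 * x1 + l2 * x2) =
     (b11 * x1 * y1 + b12 * x1 * y2 + b21 * x2 * y1 + b22 * x2 * y2) * (m1 * x1 + m2 * x2)" for x1 x2 y1 y2
  proof -
    define x where "x = smul x1 v1 + smul x2 v2"
    define y where "y = smul y1 v1 + smul y2 v2"
    have yx: "y \<odot> x = smul (b11 * y1 * x1 + b12 * y1 * x2 + b21 * y2 * x1 + b22 * y2 * x2) z +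
        smul (g11 * y1 * x1 + g12 * y1 * x2 + g21 * y2 * x1 + g22 * y2 * x2) w"
      using mult[of y1 y2 0 0 x1 x2 0 0] by (simp add: x_def y_def)
    have xy: "x \<odot> y = smul (b11 * x1 * y1 + b12 * x1 * y2 + b21 * x2 * y1 + b22 * x2 * y2) z +
        smul (g11 * x1 * y1 + g12 * x1 * y2 + g21 * x2 * y1 + g22 * x2 * y2) w"
      using mult[of x1 x2 0 0 y1 y2 0 0] by (simp add: x_def y_def)
    have xz: "x \<odot> (smul \<beta> z + smul \<gamma> w) = smul (\<beta> * (l1 * x1 + l2 * x2)) w"
      "(smul \<beta> z + smul \<gamma> w) \<odot> x = smul (\<beta> * (m1 * x1 + m2 * x2)) w" for \<beta> \<gamma>
      using mult[of x1 x2 0 0 0 0 \<beta> \<gamma>] mult[of 0 0 \<beta> \<gamma> x1 x2 0 0]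
      by (simp_all add: x_def mult.commute)
    have "x \<odot> (y \<odot> x) = (x \<odot> y) \<odot> x" by (rule flexible)
    then show ?thesis unfolding xy yx xz using \<open>w \<noteq> 0\<close> by simp
  qed
  have e: "b11 * l1 = b11 * m1" "b12 * l2 = b21 * m2" "b21 * l1 = b12 * m1" "b22 * l2 = b22 * m2"
    using flex[of 1 1 0 0] flex[of 1 0 0 1] flex[of 0 1 1 0] flex[of 0 0 1 1] flex[of 0 1 0 1]
      flex[where ?x1.0 = 1 and ?x2.0 = 0 and ?y1.0 = 1 and ?y2.0 = 0]
      flex[where ?x1.0 = 1 and ?x2.0 = 0 and ?y1.0 = 0 and ?y2.0 = 1]
      flex[where ?x1.0 = 0 and ?x2.0 = 1 and ?y1.0 = 1 and ?y2.0 = 0]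
      flex[where ?x1.0 = 0 and ?x2.0 = 1 and ?y1.0 = 0 and ?y2.0 = 1]
    by simp_all
  \<comment> \<open>Evaluation at x = v1 + v2; subtracting the pure coefficients \<open>e\<close>
    leaves the mixed ones.\<close>
  have "(b11 + b12) * (l1 + l2) = (b11 + b21) * (m1 + m2)"
    "(b21 + b22) * (l1 + l2) = (b12 + b22) * (m1 + m2)"
    using flex[where ?x1.0 = 1 and ?x2.0 = 1 and ?y1.0 = 1 and ?y2.0 = 0]
      flex[where ?x1.0 = 1 and ?x2.0 = 1 and ?y1.0 = 0 and ?y2.0 = 1]
    by simp_all
  with e have e': "b11 * l2 + b12 * l1 = b11 * m2 + b21 * m1" "b21 * l2 + b22 * l1 = b12 * m2 + b22 * m1"
    by algebra+
  consider "b11 \<noteq> 0" | "b22 \<noteq> 0" | "b11 = 0" "b22 = 0" by blast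
  then show ?thesis
  proof cases
    case 1
    then have "m1 = l1" using e by simp
    then show ?thesis using 1 e e' l by (cases "l1 = 0") auto
  next
    case 2
    then have "m2 = l2" using e by simp
    then show ?thesis using 2 e e' l by (cases "l2 = 0") auto
  next
    case 3
    \<comment> \<open>For instance b12 l1 = b21 m1 and b21 l1 = b12 m1 give b12^2 l1 = b12 b21 m1 =
      b21^2 l1.\<close>
    have sq: "l1 * (b12\<^sup>2 - b21\<^sup>2) = 0" "l2 * (b12\<^sup>2 - b21\<^sup>2) = 0"
      "m1 * (b12\<^sup>2 - b21\<^sup>2) = 0" "m2 * (b12\<^sup>2 - b21\<^sup>2) = 0"
      using e e' 3 by algebra+
    then have "b21\<^sup>2 = b12\<^sup>2" using l by auto
    then consider "b21 = b12" | "b21 = - b12" by (auto simp: power2_eq_iff)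
    then show ?thesis
    proof cases
      case 1
      then show ?thesis using 3 b e e' by auto
    next
      case 2
      then have "b12 \<noteq> 0" using 3 b by auto
      moreover have "b12 * (l1 + m1) = 0" "b12 * (l2 + m2) = 0"
        using e(2,3) 2 by (simp_all add: distrib_left) (metis add.right_inverse)
      ultimately have "m1 = - l1" "m2 = - l2" by (simp_all add: eq_neg_iff_add_eq_0 add.commute)
      then show ?thesis using 2 3 by simp
    qed
  qed
qed

lemma isomorphic_J_mult: "\<exists>n\<in>{1..18}. algebra_isomorphic smul (\<odot>) (*s) (J_mult n)"
proof (cases "dim (lower_series 1) = 3")
  case True
  then show ?thesis by (intro bexI[of _ 18] isomorphic_J_18) auto
next
  case False
  then have "dim (lower_series 1) = 2" using dim_lower_series(1) by simp
  then obtain v1 v2 z w b11 b12 b21 b22 g11 g12 g21 g22 l1 l2 m1 m2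
    where A: "adapted_basis v1 v2 z w b11 b12 b21 b22 g11 g12 g21 g22 l1 l2 m1 m2"
      and w: "w \<noteq> 0" and b: "b11 \<noteq> 0 \<or> b12 \<noteq> 0 \<or> b21 \<noteq> 0 \<or> b22 \<noteq> 0"
      and l: "l1 \<noteq> 0 \<or> l2 \<noteq> 0 \<or> m1 \<noteq> 0 \<or> m2 \<noteq> 0"
    by (rule obtain_adapted_basis)
  have A': "has_adapted_basis b11 b12 b21 b22 g11 g12 g21 g22 l1 l2 m1 m2"
    using A unfolding has_adapted_basis_def by blast
  from flexible_dichotomy[OF A w b l] show ?thesis
  proof (elim disjE conjE)
    assume eq: "m1 = l1" "m2 = l2" "b21 = b12"
    have "has_adapted_basis b11 b12 b12 b22 g11 g12 g21 g22 l1 l2 (1 * l1) (1 * l2)"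
      using A' eq by simp
    moreover have "l1 \<noteq> 0 \<or> l2 \<noteq> 0" using l eq by simp
    ultimately obtain p1 p2 q1 q2 g11' g12' g21' g22' where det: "p1 * q2 - p2 * q1 \<noteq> 0"
      and R: "has_adapted_basis (b11 * p1 * p1 + b12 * p1 * p2 + b12 * p2 * p1 + b22 * p2 * p2)
        (b11 * p1 * q1 + b12 * p1 * q2 + b12 * p2 * q1 + b22 * p2 * q2)
        (b11 * q1 * p1 + b12 * q1 * p2 + b12 * q2 * p1 + b22 * q2 * p2)
        (b11 * q1 * q1 + b12 * q1 * q2 + b12 * q2 * q1 + b22 * q2 * q2)
        g11' g12' g21' g22' 1 0 1 0"
      by (rule has_adapted_basis_rotate)
    define c11 where "c11 = b11 * p1 * p1 + b12 * p1 * p2 + b12 * p2 * p1 + b22 * p2 * p2"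
    define c12 where "c12 = b11 * p1 * q1 + b12 * p1 * q2 + b12 * p2 * q1 + b22 * p2 * q2"
    define c22 where "c22 = b11 * q1 * q1 + b12 * q1 * q2 + b12 * q2 * q1 + b22 * q2 * q2"
    have "b11 * q1 * p1 + b12 * q1 * p2 + b12 * q2 * p1 + b22 * q2 * p2 = c12"
      by (simp add: c12_def algebra_simps)
    with R have "has_adapted_basis c11 c12 c12 c22 g11' g12' g21' g22' 1 0 1 0"
      by (simp add: c11_def c12_def c22_def)
    moreover have "c11 \<noteq> 0 \<or> c12 \<noteq> 0 \<or> c22 \<noteq> 0"
    proof (rule ccontr)
      assume "\<not> ?thesis"
      then have "c11 = 0" "c12 = 0" "c22 = 0" by auto
      \<comment> \<open>Inverting the congruence: the old entries times the squared determinant are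
        combinations of the new ones, so a nonzero b stays nonzero.\<close>
      moreover have "b11 * (p1 * q2 - p2 * q1)\<^sup>2 = c11 * q2\<^sup>2 - 2 * c12 * q2 * p2 + c22 * p2\<^sup>2"
        "b22 * (p1 * q2 - p2 * q1)\<^sup>2 = c11 * q1\<^sup>2 - 2 * c12 * q1 * p1 + c22 * p1\<^sup>2"
        "b12 * (p1 * q2 - p2 * q1)\<^sup>2 = - c11 * q1 * q2 + c12 * (p1 * q2 + p2 * q1) - c22 * p1 * p2"
        unfolding c11_def c12_def c22_def by algebra+
      ultimately show False using b det eq by auto
    qed
    ultimately show ?thesis by (rule isomorphic_if_symmetric[OF dim_4])
  next
    assume eq: "m1 = - l1" "m2 = - l2" "b11 = 0" "b22 = 0" "b21 = - b12"
    have "has_adapted_basis 0 b12 (- b12) 0 g11 g12 g21 g22 l1 l2 (-1 * l1) (-1 * l2)"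
      using A' eq by simp
    moreover have "l1 \<noteq> 0 \<or> l2 \<noteq> 0" using l eq by simp
    ultimately obtain p1 p2 q1 q2 g11' g12' g21' g22' where det: "p1 * q2 - p2 * q1 \<noteq> 0"
      and R: "has_adapted_basis (0 * p1 * p1 + b12 * p1 * p2 + - b12 * p2 * p1 + 0 * p2 * p2)
        (0 * p1 * q1 + b12 * p1 * q2 + - b12 * p2 * q1 + 0 * p2 * q2)
        (0 * q1 * p1 + b12 * q1 * p2 + - b12 * q2 * p1 + 0 * q2 * p2)
        (0 * q1 * q1 + b12 * q1 * q2 + - b12 * q2 * q1 + 0 * q2 * q2)
        g11' g12' g21' g22' 1 0 (-1) 0"
      by (rule has_adapted_basis_rotate)
    define c where "c = b12 * (p1 * q2 - p2 * q1)"
    have "0 * p1 * p1 + b12 * p1 * p2 + - b12 * p2 * p1 + 0 * p2 * p2 = 0"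
      "0 * p1 * q1 + b12 * p1 * q2 + - b12 * p2 * q1 + 0 * p2 * q2 = c"
      "0 * q1 * p1 + b12 * q1 * p2 + - b12 * q2 * p1 + 0 * q2 * p2 = - c"
      "0 * q1 * q1 + b12 * q1 * q2 + - b12 * q2 * q1 + 0 * q2 * q2 = 0"
      by (simp_all add: c_def algebra_simps)
    with R have "has_adapted_basis 0 c (- c) 0 g11' g12' g21' g22' 1 0 (-1) 0"
      by (simp only:)
    moreover have "c \<noteq> 0" using b eq det by (auto simp: c_def)
    ultimately show ?thesis by (rule isomorphic_if_alternating[OF dim_4])
  qed
qed

end

lemma isomorphic_J_mult_if_ncj4:
  fixes smul :: "complex \<Rightarrow> 'a::ab_group_add \<Rightarrow> 'a"
  assumes "nontrivial_nilpotent_ncj_dim4 smul amul"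
  shows "\<exists>n\<in>{1..18}. algebra_isomorphic smul amul (*s) (J_mult n)"
proof -
  note A = assms[unfolded nontrivial_nilpotent_ncj_dim4_def]
  interpret noncommutative_jordan_algebra smul amul using A by blast
  obtain B where B: "independent B" "span B = UNIV" "card B = dim (UNIV :: 'a set)"
    using basis_exists[of UNIV] by (metis top.extremum_uniqueI)
  have "finite B" using B(3) A card.infinite by fastforce
  interpret nilpotent_ncj4 smul amul B
    by unfold_locales (use A B \<open>finite B\<close> in auto)
  show ?thesis by (rule isomorphic_J_mult)
qed

theorem theoremA:
  shows "(\<forall>n\<in>{1..18}. nontrivial_nilpotent_ncj_dim4 (*s) (J_mult n)) \<and>
    (\<forall>m\<in>{1..18}. \<forall>n\<in>{1..18}. m \<noteq> n \<longrightarrow>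
       \<not> algebra_isomorphic (*s) (J_mult m) (*s) (J_mult n)) \<and>
    (\<forall>(smul :: complex \<Rightarrow> 'a::ab_group_add \<Rightarrow> 'a) amul.
       nontrivial_nilpotent_ncj_dim4 smul amul \<longrightarrow>
       (\<exists>!n. n \<in> {1..18} \<and> algebra_isomorphic smul amul (*s) (J_mult n)))"
proof (intro conjI ballI allI impI)
  fix n :: nat assume n: "n \<in> {1..18}"
  show "nontrivial_nilpotent_ncj_dim4 (*s) (J_mult n)"
    by (rule nontrivial_nilpotent_ncj_dim4_J_mult[OF n])
next
  fix m n :: nat assume mn: "m \<in> {1..18}" "n \<in> {1..18}" "m \<noteq> n"
  show "\<not> algebra_isomorphic (*s) (J_mult m) (*s) (J_mult n)"
    using J_index_isomorphic[of "(*s)" "J_mult m" "(*s)" "J_mult n"] mn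
    by (auto simp: J_index_J_mult)
next
  fix smul :: "complex \<Rightarrow> 'a \<Rightarrow> 'a" and amul
  assume "nontrivial_nilpotent_ncj_dim4 smul amul"
  then obtain n where n: "n \<in> {1..18}" "algebra_isomorphic smul amul (*s) (J_mult n)"
    using isomorphic_J_mult_if_ncj4 by blast
  show "\<exists>!n. n \<in> {1..18} \<and> algebra_isomorphic smul amul (*s) (J_mult n)"
  proof (intro ex1I conjI)
    \<comment> \<open>Both m and n are the value of \<open>J_index amul\<close>.\<close>
    fix m assume m: "m \<in> {1..18} \<and> algebra_isomorphic smul amul (*s) (J_mult m)"
    then show "m = n"
      using J_index_isomorphic[OF n(2)] J_index_isomorphic[of smul amul "(*s)" "J_mult m"] n(1)
      by (simp add: J_index_J_mult)
  qed (use n in auto)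
qed

end
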